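(* Let $G$ be a compact abelian group with character group $\Gamma$ and normalized Haar measure $m_G$, and let $\Lambda \subset \Gamma$ be an infinite subset. Then the following are equivalent: (a) $\Lambda$ is a $\Lambda(p)$-set for all $2<p<\infty$. (b) $\lambda(\Pi_\Lambda,u,v)=\lambda(\Pi_\gamma,u,v)$ for all $1\le u,v\le\infty$.
   Context: All Banach spaces are complex; $B_E$ is the closed unit ball and $E'$ the dual of a Banach space $E$. $B$-summing operators: let $B\subset L_2(\mu)$ be an infinite orthonormal system over a probability space $(\Omega,\mu)$. A bounded linear operator $T:E\to F$ between Banach spaces is $B$-summing if there is a constant $c>0$ such that for all finite sequences $b_1,\dots,b_n$ of distinct elements of $B$ and all $x_1,\dots,x_n\in E$ $$\left(\int_\Omega \Big\|\sum_{i=1}^n b_i\cdot Tx_i\Big\|^2 d\mu\right)^{1/2}\le c\cdot \sup_{x'\in B_{E'}}\left(\sum_{i=1}^n|\langle x',x_i\rangle|^2\right)^{1/2}.$$ The smallest such $c$ is denoted $\pi_B(T)$; $(\Pi_B,\pi_B)$ is the Banach operator ideal of all $B$-summing operators. $\Pi_\gamma$ (with norm $\pi_\gamma$), the ideal of Gaussian-summing operators, is $\Pi_B$ for $B$ a sequence of independent standard Gaussian random variables. $\Pi_\Lambda$ is $\Pi_B$ for $B=\Lambda$, viewed as an orthonormal system in $L_2(G,m_G)$. Limit order: for a Banach operator ideal $(\mathcal A,A)$ and $1\le u,v\le\infty$, $$\lambda(\mathcal A,u,v):=\inf\{\lambda>0 \mid \exists\,\rho>0\ \forall\, n\in\mathbb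 N:\ A(\mathrm{id}:\ell_u^n\hookrightarrow\ell_v^n)\le\rho\cdot n^\lambda\}.$$ $\Lambda(p)$-sets: for $2<p<\infty$, a subset $\Lambda\subset\Gamma$ is a $\Lambda(p)$-set if there is a constant $c>0$ such that $\|f\|_{L_p(G,m_G)}\le c\cdot\|f\|_{L_2(G,m_G)}$ for all $f\in\mathrm{span}(\Lambda)$. *)

theory Defs
  imports "HOL-Probability.Probability" "HOL-Library.Function_Algebras"
begin

text \<open>
  A complex normed space is given by a scalar multiplication on an ambient additive group,
  a complex-linear subspace of it (the carrier) and a norm, of which only the values on the
  carrier matter. Carriers are needed because the limit order quantifies over the dimension
  of the spaces involved.
\<close>

record 'a cnormed =
  cscale :: "complex \<Rightarrow> 'a \<Rightarrow> 'a"
  points :: "'a set"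
  nrm :: "'a \<Rightarrow> real"

definition complex_normed_space :: "'a::ab_group_add cnormed \<Rightarrow> bool" where
  "complex_normed_space E \<longleftrightarrow>
     vector_space (cscale E) \<and> module.subspace (cscale E) (points E) \<and>
     (\<forall>x\<in>points E. 0 \<le> nrm E x \<and> (nrm E x = 0 \<longleftrightarrow> x = 0)) \<and>
     (\<forall>a. \<forall>x\<in>points E. nrm E (cscale E a x) = cmod a * nrm E x) \<and>
     (\<forall>x\<in>points E. \<forall>y\<in>points E. nrm E (x + y) \<le> nrm E x + nrm E y)"

definition complex_banach_space :: "'a::ab_group_add cnormed \<Rightarrow> bool" where
  "complex_banach_space E \<longleftrightarrow>
     complex_normed_space E \<and>
     (\<forall>X. (\<forall>k. X k \<in> points E) \<and>
          (\<forall>e>0. \<exists>N. \<forall>j\<ge>N. \<forall>k\<ge>N. nrm E (X j - X k) < e) \<longrightarrow>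
          (\<exists>x\<in>points E. (\<lambda>k. nrm E (X k - x)) \<longlonglongrightarrow> 0))"

definition bounded_operator ::
  "'a::ab_group_add cnormed \<Rightarrow> 'b::ab_group_add cnormed \<Rightarrow> ('a \<Rightarrow> 'b) \<Rightarrow> bool" where
  "bounded_operator E F T \<longleftrightarrow>
     (\<forall>x\<in>points E. T x \<in> points F) \<and>
     (\<forall>x\<in>points E. \<forall>y\<in>points E. T (x + y) = T x + T y) \<and>
     (\<forall>a. \<forall>x\<in>points E. T (cscale E a x) = cscale F a (T x)) \<and>
     (\<exists>K. \<forall>x\<in>points E. nrm F (T x) \<le> K * nrm E x)"

definition complex_line :: "complex cnormed" where
  "complex_line = \<lparr>cscale = (*), points = UNIV, nrm = cmod\<rparr>"

definition dual_ball :: "'a::ab_group_add cnormed \<Rightarrow> ('a \<Rightarrow> complex) set" where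
  "dual_ball E = {\<phi>. bounded_operator E complex_line \<phi> \<and> (\<forall>x\<in>points E. cmod (\<phi> x) \<le> nrm E x)}"

text \<open>
  Elements of \<open>L\<^sub>2\<close> are represented by functions; distinct members of an orthonormal
  system are distinct almost everywhere, so a set of functions is an adequate representation.
\<close>

definition infinite_orthonormal_system :: "'w measure \<Rightarrow> ('w \<Rightarrow> complex) set \<Rightarrow> bool" where
  "infinite_orthonormal_system M B \<longleftrightarrow>
     infinite B \<and>
     (\<forall>b\<in>B. b \<in> borel_measurable M \<and> integrable M (\<lambda>\<omega>. (cmod (b \<omega>))\<^sup>2)) \<and>
     (\<forall>b\<in>B. \<forall>b'\<in>B. (LINT \<omega>|M. b \<omega> * cnj (b' \<omega>)) = (if b = b' then 1 else 0))"

definition B_summing_with ::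
  "'w measure \<Rightarrow> ('w \<Rightarrow> complex) set \<Rightarrow> 'a::ab_group_add cnormed \<Rightarrow> 'b::ab_group_add cnormed \<Rightarrow>
   ('a \<Rightarrow> 'b) \<Rightarrow> real \<Rightarrow> bool" where
  "B_summing_with M B E F T c \<longleftrightarrow>
     bounded_operator E F T \<and>
     (\<forall>(n::nat) b x. inj_on b {..<n} \<and> b ` {..<n} \<subseteq> B \<and> x ` {..<n} \<subseteq> points E \<longrightarrow>
        sqrt (LINT \<omega>|M. (nrm F (\<Sum>i<n. cscale F (b i \<omega>) (T (x i))))\<^sup>2)
        \<le> c * (SUP \<phi>\<in>dual_ball E. sqrt (\<Sum>i<n. (cmod (\<phi> (x i)))\<^sup>2)))"

definition B_summing ::
  "'w measure \<Rightarrow> ('w \<Rightarrow> complex) set \<Rightarrow> 'a::ab_group_add cnormed \<Rightarrow> 'b::ab_group_add cnormed \<Rightarrow>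
   ('a \<Rightarrow> 'b) \<Rightarrow> bool" where
  "B_summing M B E F T \<longleftrightarrow> (\<exists>c>0. B_summing_with M B E F T c)"

text \<open>The value is \<open>\<infinity>\<close> precisely for operators that are not \<open>B\<close>-summing.\<close>

definition pi_summing ::
  "'w measure \<Rightarrow> ('w \<Rightarrow> complex) set \<Rightarrow> 'a::ab_group_add cnormed \<Rightarrow> 'b::ab_group_add cnormed \<Rightarrow>
   ('a \<Rightarrow> 'b) \<Rightarrow> ereal" where
  "pi_summing M B E F T = (INF c\<in>{c. 0 < c \<and> B_summing_with M B E F T c}. ereal c)"

definition scale_fun :: "complex \<Rightarrow> ('i \<Rightarrow> complex) \<Rightarrow> 'i \<Rightarrow> complex" where
  "scale_fun a f = (\<lambda>i. a * f i)"

text \<open>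
  Vectors of length \<open>n\<close> are functions on \<open>nat\<close> vanishing outside \<open>{..<n}\<close>. The inserted
  \<open>0\<close> in the maximum only matters for \<open>n = 0\<close>.
\<close>

definition lp_norm :: "nat \<Rightarrow> ereal \<Rightarrow> (nat \<Rightarrow> complex) \<Rightarrow> real" where
  "lp_norm n u x =
     (if u = \<infinity> then Max (insert 0 ((\<lambda>i. cmod (x i)) ` {..<n}))
      else (\<Sum>i<n. cmod (x i) powr real_of_ereal u) powr (1 / real_of_ereal u))"

definition lp_space :: "nat \<Rightarrow> ereal \<Rightarrow> (nat \<Rightarrow> complex) cnormed" where
  "lp_space n u = \<lparr>cscale = scale_fun, points = {x. \<forall>i\<ge>n. x i = 0}, nrm = lp_norm n u\<rparr>"

text \<open>
  The argument \<open>A\<close> is an ideal norm, with value \<open>\<infinity>\<close> off the ideal; the limit order only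
  depends on its values at operators between the spaces \<open>lp_space n u\<close>.
\<close>

definition limit_order ::
  "((nat \<Rightarrow> complex) cnormed \<Rightarrow> (nat \<Rightarrow> complex) cnormed \<Rightarrow>
    ((nat \<Rightarrow> complex) \<Rightarrow> (nat \<Rightarrow> complex)) \<Rightarrow> ereal) \<Rightarrow> ereal \<Rightarrow> ereal \<Rightarrow> ereal" where
  "limit_order A u v =
     (INF l\<in>{l::real. 0 < l \<and>
        (\<exists>\<rho>>0. \<forall>n\<ge>1. A (lp_space n u) (lp_space n v) id \<le> ereal (\<rho> * real n powr l))}. ereal l)"

definition gaussian_system :: "(nat \<Rightarrow> 'w \<Rightarrow> real) \<Rightarrow> ('w \<Rightarrow> complex) set" where
  "gaussian_system g = range (\<lambda>i \<omega>. complex_of_real (g i \<omega>))"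

definition independent_standard_gaussians :: "'w measure \<Rightarrow> (nat \<Rightarrow> 'w \<Rightarrow> real) \<Rightarrow> bool" where
  "independent_standard_gaussians P g \<longleftrightarrow>
     prob_space P \<and> prob_space.indep_vars P (\<lambda>_. borel) g UNIV \<and>
     (\<forall>i. distributed P lborel (g i) std_normal_density)"

definition characters :: "('g::topological_ab_group_add \<Rightarrow> complex) set" where
  "characters = {h. continuous_on UNIV h \<and> (\<forall>x. cmod (h x) = 1) \<and> (\<forall>x y. h (x + y) = h x * h y)}"

text \<open>
  On a compact group that is not metrizable, translation invariance on the Borel sets has to be
  complemented by regularity.
\<close>

definition normalized_haar_measure :: "'g::topological_ab_group_add measure \<Rightarrow> bool" where
  "normalized_haar_measure m \<longleftrightarrow>
     sets m = sets borel \<and> prob_space m \<and>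
     (\<forall>a. \<forall>A\<in>sets borel. emeasure m ((+) a ` A) = emeasure m A) \<and>
     (\<forall>A\<in>sets borel. emeasure m A = (INF U\<in>{U. open U \<and> A \<subseteq> U}. emeasure m U)) \<and>
     (\<forall>U. open U \<longrightarrow> emeasure m U = (SUP K\<in>{K. compact K \<and> K \<subseteq> U}. emeasure m K))"

definition Lp_norm :: "real \<Rightarrow> 'g measure \<Rightarrow> ('g \<Rightarrow> complex) \<Rightarrow> real" where
  "Lp_norm p m f = (LINT x|m. cmod (f x) powr p) powr (1 / p)"

definition Lambda_p_set :: "'g measure \<Rightarrow> real \<Rightarrow> ('g \<Rightarrow> complex) set \<Rightarrow> bool" where
  "Lambda_p_set m p \<Lambda> \<longleftrightarrow>
     (\<exists>c>0. \<forall>f\<in>module.span scale_fun \<Lambda>. Lp_norm p m f \<le> c * Lp_norm 2 m f)"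

text \<open>
  The remaining facts confirm that the objects to which the definitions are applied satisfy the
  standing assumptions: the spaces \<open>lp_space n u\<close> are Banach spaces, and characters and
  independent Gaussian variables form orthonormal systems.
\<close>

lemma vector_space_scale_fun: "vector_space (scale_fun :: complex \<Rightarrow> ('i \<Rightarrow> complex) \<Rightarrow> _)"
  by unfold_locales (auto simp: scale_fun_def fun_eq_iff algebra_simps)

lemma powr_convex_nonneg:
  fixes x y s t p :: real
  assumes "1 \<le> p" "0 \<le> x" "0 \<le> y" "0 < s" "0 < t" "s + t = 1"
  shows "(s * x + t * y) powr p \<le> s * x powr p + t * y powr p"
proof -
  have small: "(r * z) powr p \<le> r * z powr p" if "0 < r" "r \<le> 1" "0 \<le> z" for r z :: real
  proof -
    have "r powr p \<le> r powr 1"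
      using that assms(1) by (intro powr_mono') auto
    then show ?thesis
      using that by (simp add: powr_mult mult_right_mono)
  qed
  consider "x = 0" | "y = 0" | "0 < x" "0 < y" using assms by linarith
  then show ?thesis
  proof cases
    case 1
    then show ?thesis using small[of t y] assms by simp
  next
    case 2
    then show ?thesis using small[of s x] assms by simp
  next
    case 3
    have "s = 1 - t" using assms(6) by simp
    then show ?thesis
      using 3 convex_onD[OF powr_convex[OF assms(1)], of t x y] assms(4,5) by simp
  qed
qed

lemma minkowski_sum:
  fixes a b :: "nat \<Rightarrow> real"
  assumes p: "1 \<le> p" and ab: "\<And>i. 0 \<le> a i" "\<And>i. 0 \<le> b i"
  shows "(\<Sum>i<n. (a i + b i) powr p) powr (1 / p)
         \<le> (\<Sum>i<n. a i powr p) powr (1 / p) + (\<Sum>i<n. b i powr p) powr (1 / p)"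
proof -
  define A where "A = (\<Sum>i<n. a i powr p) powr (1 / p)"
  define B where "B = (\<Sum>i<n. b i powr p) powr (1 / p)"
  have Ap: "A powr p = (\<Sum>i<n. a i powr p)" and Bp: "B powr p = (\<Sum>i<n. b i powr p)"
    using p by (simp_all add: A_def B_def powr_powr sum_nonneg)
  have AB: "0 \<le> A" "0 \<le> B" by (simp_all add: A_def B_def)
  consider "A = 0" | "B = 0" | "0 < A" "0 < B" using AB by linarith
  then have "(\<Sum>i<n. (a i + b i) powr p) powr (1 / p) \<le> A + B"
  proof cases
    case 1
    then have "(\<Sum>i<n. a i powr p) = 0" using Ap p by simp
    then have "\<forall>i<n. a i = 0" by (subst (asm) sum_nonneg_eq_0_iff) auto
    then show ?thesis using 1 by (simp add: B_def)
  next
    case 2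
    then have "(\<Sum>i<n. b i powr p) = 0" using Bp p by simp
    then have "\<forall>i<n. b i = 0" by (subst (asm) sum_nonneg_eq_0_iff) auto
    then show ?thesis using 2 by (simp add: A_def)
  next
    case 3
    define s where "s = A / (A + B)"
    define t where "t = B / (A + B)"
    have st: "0 < s" "0 < t" "s + t = 1"
      using 3 by (simp_all add: s_def t_def add_divide_distrib[symmetric])
    have le: "(a i + b i) powr p
        \<le> (A + B) powr p * (s * (a i powr p / A powr p) + t * (b i powr p / B powr p))" for i
    proof -
      have eq: "a i + b i = (A + B) * (s * (a i / A) + t * (b i / B))"
      proof -
        have "(A + B) * (s * (a i / A)) = a i" "(A + B) * (t * (b i / B)) = b i"
          using 3 by (simp_all add: s_def t_def)
        then show ?thesis by (simp only: distrib_left)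
      qed
      have "(s * (a i / A) + t * (b i / B)) powr p
          \<le> s * (a i / A) powr p + t * (b i / B) powr p"
        using p ab 3 st by (intro powr_convex_nonneg) auto
      then have "(A + B) powr p * (s * (a i / A) + t * (b i / B)) powr p
          \<le> (A + B) powr p * (s * (a i / A) powr p + t * (b i / B) powr p)"
        by (intro mult_left_mono) auto
      then show ?thesis
        using ab[of i] 3 st by (subst eq) (simp add: powr_mult powr_divide)
    qed
    have "(\<Sum>i<n. (a i + b i) powr p)
        \<le> (\<Sum>i<n. (A + B) powr p * (s * (a i powr p / A powr p) + t * (b i powr p / B powr p)))"
      by (intro sum_mono le)
    also have "\<dots> = (A + B) powr p * (s * ((\<Sum>i<n. a i powr p) / A powr p)
        + t * ((\<Sum>i<n. b i powr p) / B powr p))"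
      by (simp only: sum_divide_distrib sum_distrib_left sum.distrib distrib_left)
    also have "\<dots> = (A + B) powr p"
      using 3 st by (simp flip: Ap Bp)
    finally have "(\<Sum>i<n. (a i + b i) powr p) powr (1 / p) \<le> ((A + B) powr p) powr (1 / p)"
      using p by (intro powr_mono2) (auto intro: sum_nonneg)
    also have "\<dots> = A + B" using p 3 by (simp add: powr_powr)
    finally show ?thesis .
  qed
  then show ?thesis by (simp add: A_def B_def)
qed

lemma exponent_cases:
  assumes "(1::ereal) \<le> u"
  obtains "u = \<infinity>" | p where "u = ereal p" "1 \<le> p"
  using assms by (cases u) (auto simp: one_ereal_def)

lemma lp_norm_infinity_le_iff:
  "0 \<le> c \<Longrightarrow> lp_norm n \<infinity> x \<le> c \<longleftrightarrow> (\<forall>i<n. cmod (x i) \<le> c)"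
  by (auto simp: lp_norm_def)

lemma cmod_le_lp_norm:
  assumes u: "1 \<le> u" and i: "i < n"
  shows "cmod (x i) \<le> lp_norm n u x"
  using u
proof (cases rule: exponent_cases)
  case 1
  then show ?thesis using i by (auto simp: lp_norm_def intro!: Max_ge)
next
  case (2 p)
  have "cmod (x i) powr p \<le> (\<Sum>i<n. cmod (x i) powr p)"
    using i by (intro member_le_sum) auto
  then have "(cmod (x i) powr p) powr (1 / p) \<le> (\<Sum>i<n. cmod (x i) powr p) powr (1 / p)"
    using 2 by (intro powr_mono2) auto
  then show ?thesis using 2 by (simp add: lp_norm_def powr_powr)
qed

lemma lp_norm_nonneg: "1 \<le> u \<Longrightarrow> 0 \<le> lp_norm n u x"
  by (auto simp: lp_norm_def intro!: Max_ge)

lemma lp_norm_triangle: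
  assumes u: "1 \<le> u"
  shows "lp_norm n u (x + y) \<le> lp_norm n u x + lp_norm n u y"
  using u
proof (cases rule: exponent_cases)
  case 1
  have "cmod ((x + y) i) \<le> lp_norm n u x + lp_norm n u y" if "i < n" for i
    using cmod_le_lp_norm[OF u that, of x] cmod_le_lp_norm[OF u that, of y]
      norm_triangle_ineq[of "x i" "y i"] by simp
  then show ?thesis
    using 1 u lp_norm_nonneg[OF u] by (simp add: lp_norm_infinity_le_iff)
next
  case (2 p)
  have "(\<Sum>i<n. cmod ((x + y) i) powr p) powr (1 / p)
      \<le> (\<Sum>i<n. (cmod (x i) + cmod (y i)) powr p) powr (1 / p)"
    using 2 by (intro powr_mono2 sum_mono sum_nonneg) (auto intro: norm_triangle_ineq)
  also have "\<dots> \<le> (\<Sum>i<n. cmod (x i) powr p) powr (1 / p) + (\<Sum>i<n. cmod (y i) powr p) powr (1 / p)"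
    using 2 by (intro minkowski_sum) auto
  finally show ?thesis using 2 by (simp add: lp_norm_def)
qed

lemma lp_norm_scale:
  assumes u: "1 \<le> u"
  shows "lp_norm n u (scale_fun a x) = cmod a * lp_norm n u x"
  using u
proof (cases rule: exponent_cases)
  case 1
  have "(*) (cmod a) (Max (insert 0 ((\<lambda>i. cmod (x i)) ` {..<n})))
      = Max ((*) (cmod a) ` insert 0 ((\<lambda>i. cmod (x i)) ` {..<n}))"
    by (intro mono_Max_commute) (auto intro!: monoI mult_left_mono)
  also have "(*) (cmod a) ` insert 0 ((\<lambda>i. cmod (x i)) ` {..<n})
      = insert 0 ((\<lambda>i. cmod (scale_fun a x i)) ` {..<n})"
    by (auto simp: scale_fun_def norm_mult image_image)
  finally show ?thesis using 1 by (simp add: lp_norm_def)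
next
  case (2 p)
  have "(\<Sum>i<n. cmod (scale_fun a x i) powr p) = cmod a powr p * (\<Sum>i<n. cmod (x i) powr p)"
    by (simp add: scale_fun_def norm_mult powr_mult sum_distrib_left)
  then show ?thesis
    using 2 by (simp add: lp_norm_def powr_mult powr_powr sum_nonneg)
qed

lemma lp_norm_le_sum:
  assumes u: "1 \<le> u"
  shows "lp_norm n u x \<le> real n * (\<Sum>i<n. cmod (x i))"
  using u
proof (cases rule: exponent_cases)
  case 1
  have "cmod (x i) \<le> real n * (\<Sum>i<n. cmod (x i))" if "i < n" for i
  proof -
    have "cmod (x i) \<le> (\<Sum>i<n. cmod (x i))" using that by (intro member_le_sum) auto
    also have "\<dots> \<le> real n * (\<Sum>i<n. cmod (x i))"
      using that mult_right_mono[of 1 "real n" "\<Sum>i<n. cmod (x i)"] by (simp add: sum_nonneg)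
    finally show ?thesis .
  qed
  then show ?thesis
    using 1 by (simp add: lp_norm_infinity_le_iff sum_nonneg)
next
  case (2 p)
  define S where "S = (\<Sum>i<n. cmod (x i))"
  have S: "0 \<le> S" by (simp add: S_def sum_nonneg)
  have "(\<Sum>i<n. cmod (x i) powr p) \<le> (\<Sum>i<n. S powr p)"
    using 2 by (intro sum_mono powr_mono2) (auto simp: S_def intro: member_le_sum)
  then have "lp_norm n u x \<le> (real n * S powr p) powr (1 / p)"
    using 2 by (auto simp: lp_norm_def intro!: powr_mono2 sum_nonneg)
  also have "\<dots> = real n powr (1 / p) * S"
    using 2 S by (simp add: powr_mult powr_powr)
  also have "\<dots> \<le> real n * S"
  proof (cases "n = 0")
    case False
    then have "real n powr (1 / p) \<le> real n powr 1" using 2 by (intro powr_mono) auto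
    then show ?thesis using S by (intro mult_right_mono) auto
  qed simp
  finally show ?thesis by (simp add: S_def)
qed

lemma lp_space_banach:
  assumes u: "1 \<le> u"
  shows "complex_banach_space (lp_space n u)"
  unfolding complex_banach_space_def
proof (intro conjI allI impI)
  interpret vector_space "scale_fun :: complex \<Rightarrow> (nat \<Rightarrow> complex) \<Rightarrow> _"
    by (rule vector_space_scale_fun)
  have "x = 0" if "\<forall>i\<ge>n. x i = 0" "lp_norm n u x = 0" for x
  proof
    fix i show "x i = 0 i"
      using cmod_le_lp_norm[OF u, of i n x] that by (cases "i < n") auto
  qed
  moreover have "lp_norm n u 0 = 0"
    using lp_norm_scale[OF u, of n 0 0] by (simp add: scale_fun_def zero_fun_def)
  ultimately show "complex_normed_space (lp_space n u)"
    using u unfolding complex_normed_space_def lp_space_def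
    by (auto simp: vector_space_scale_fun subspace_def lp_norm_nonneg lp_norm_scale
        lp_norm_triangle) (auto simp: scale_fun_def)
next
  fix X :: "nat \<Rightarrow> nat \<Rightarrow> complex"
  assume "(\<forall>k. X k \<in> points (lp_space n u)) \<and>
    (\<forall>e>0. \<exists>N. \<forall>j\<ge>N. \<forall>k\<ge>N. nrm (lp_space n u) (X j - X k) < e)"
  then have X: "\<And>k i. n \<le> i \<Longrightarrow> X k i = 0"
    and C: "\<And>e. 0 < e \<Longrightarrow> \<exists>N. \<forall>j\<ge>N. \<forall>k\<ge>N. lp_norm n u (X j - X k) < e"
    by (auto simp: lp_space_def)
  have "\<exists>l. (\<lambda>k. X k i) \<longlonglongrightarrow> l" for i
  proof (cases "i < n")
    case True
    have "Cauchy (\<lambda>k. X k i)"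
    proof (rule metric_CauchyI)
      fix e :: real assume "0 < e"
      then obtain N where N: "\<forall>j\<ge>N. \<forall>k\<ge>N. lp_norm n u (X j - X k) < e" using C by blast
      have "dist (X j i) (X k i) < e" if "N \<le> j" "N \<le> k" for j k
      proof -
        have "dist (X j i) (X k i) \<le> lp_norm n u (X j - X k)"
          using cmod_le_lp_norm[OF u True, of "X j - X k"] by (simp add: dist_norm)
        also have "\<dots> < e" using N that by simp
        finally show ?thesis .
      qed
      then show "\<exists>N. \<forall>j\<ge>N. \<forall>k\<ge>N. dist (X j i) (X k i) < e" by blast
    qed
    then show ?thesis by (simp add: Cauchy_convergent_iff convergent_def)
  qed (auto simp: X)
  then obtain x where x: "(\<lambda>k. X k i) \<longlonglongrightarrow> x i" for i by metis
  have "x i = 0" if "n \<le> i" for i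
    using x[of i] X[OF that] by (simp add: LIMSEQ_const_iff)
  moreover have "(\<lambda>k. lp_norm n u (X k - x)) \<longlonglongrightarrow> 0"
  proof (rule tendsto_sandwich[where f = "\<lambda>_. 0" and h = "\<lambda>k. real n * (\<Sum>i<n. cmod (X k i - x i))"])
    have "(\<lambda>k. real n * (\<Sum>i<n. cmod (X k i - x i))) \<longlonglongrightarrow> real n * (\<Sum>i<n. cmod (x i - x i))"
      by (intro tendsto_intros x)
    then show "(\<lambda>k. real n * (\<Sum>i<n. cmod (X k i - x i))) \<longlonglongrightarrow> 0" by simp
    show "\<forall>\<^sub>F k in sequentially. lp_norm n u (X k - x) \<le> real n * (\<Sum>i<n. cmod (X k i - x i))"
      using lp_norm_le_sum[OF u, of n "X k - x" for k] by simp
  qed (auto simp: lp_norm_nonneg u)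
  ultimately show "\<exists>x\<in>points (lp_space n u). (\<lambda>k. nrm (lp_space n u) (X k - x)) \<longlonglongrightarrow> 0"
    by (intro bexI[of _ x]) (auto simp: lp_space_def)
qed

lemma normalized_haar_measureD:
  assumes "normalized_haar_measure m"
  shows "sets m = sets borel" "prob_space m"
    "A \<in> sets borel \<Longrightarrow> emeasure m ((+) a ` A) = emeasure m A"
proof -
  from assms have *: "sets m = sets borel \<and> prob_space m \<and>
      (\<forall>a. \<forall>A\<in>sets borel. emeasure m ((+) a ` A) = emeasure m A)"
    unfolding normalized_haar_measure_def by (elim conjE) (intro conjI)
  from * show "sets m = sets borel" by (rule conjunct1)
  from * show "prob_space m" by (elim conjE)
  from * have "\<forall>a. \<forall>A\<in>sets borel. emeasure m ((+) a ` A) = emeasure m A" by (elim conjE)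
  then show "A \<in> sets borel \<Longrightarrow> emeasure m ((+) a ` A) = emeasure m A" by (elim allE) (rule bspec)
qed

lemma haar_integral_translate:
  fixes f :: "'g::topological_ab_group_add \<Rightarrow> complex"
  assumes m: "normalized_haar_measure m" and f: "continuous_on UNIV f"
  shows "(LINT x|m. f (a + x)) = (LINT x|m. f x)"
proof -
  have sm: "sets m = sets borel" using m by (rule normalized_haar_measureD)
  then have sp: "space m = UNIV" using sets_eq_imp_space_eq[OF sm] by (simp only: space_borel)
  have "continuous_on UNIV ((+) a)" by (intro continuous_intros)
  then have meas: "(+) a \<in> measurable m m"
    using borel_measurable_continuous_onI measurable_cong_sets[OF sm sm] by blast
  have "distr m m ((+) a) = m"
  proof (rule measure_eqI)
    fix A assume "A \<in> sets (distr m m ((+) a))"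
    then have A: "A \<in> sets m" by simp
    have "(+) a -` A = (+) (- a) ` A"
      by (auto simp: image_iff intro!: bexI[of _ "a + _"])
    moreover have "emeasure m ((+) (- a) ` A) = emeasure m A"
      using A sm by (intro normalized_haar_measureD(3)[OF m]) simp
    ultimately show "emeasure (distr m m ((+) a)) A = emeasure m A"
      using sp by (simp add: emeasure_distr[OF meas A])
  qed simp
  moreover have "f \<in> borel_measurable m"
    using borel_measurable_continuous_onI[OF f] measurable_cong_sets[OF sm refl] by blast
  ultimately show ?thesis using integral_distr[OF meas, of f] by (simp only:)
qed

lemma characters_orthonormal:
  assumes m: "normalized_haar_measure m"
    and \<Lambda>: "\<Lambda> \<subseteq> characters" "infinite \<Lambda>"
  shows "infinite_orthonormal_system m \<Lambda>"
  unfolding infinite_orthonormal_system_def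
proof (intro conjI ballI)
  show "infinite \<Lambda>" by fact
  have sm: "sets m = sets borel" using m by (rule normalized_haar_measureD)
  interpret prob_space m using m by (rule normalized_haar_measureD)
  fix b assume "b \<in> \<Lambda>"
  then have b: "continuous_on UNIV b" "cmod (b x) = 1" "b (x + y) = b x * b y" for x y
    using \<Lambda> by (auto simp: characters_def)
  show "b \<in> borel_measurable m"
    using borel_measurable_continuous_onI[OF b(1)] measurable_cong_sets[OF sm refl] by blast
  show "integrable m (\<lambda>\<omega>. (cmod (b \<omega>))\<^sup>2)" by (simp add: b)
  fix b' assume "b' \<in> \<Lambda>"
  then have b': "continuous_on UNIV b'" "cmod (b' x) = 1" "b' (x + y) = b' x * b' y" for x y
    using \<Lambda> by (auto simp: characters_def)
  have inv: "b' x * cnj (b' x) = 1" for x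
    using b'(2)[of x] by (simp add: complex_norm_square[symmetric])
  show "(LINT \<omega>|m. b \<omega> * cnj (b' \<omega>)) = (if b = b' then 1 else 0)"
  proof (cases "b = b'")
    case True
    then show ?thesis by (simp add: inv prob_space)
  next
    case False
    then obtain a where a: "b a \<noteq> b' a" by (auto simp: fun_eq_iff)
    let ?I = "LINT \<omega>|m. b \<omega> * cnj (b' \<omega>)"
    have "?I = (LINT \<omega>|m. b (a + \<omega>) * cnj (b' (a + \<omega>)))"
      by (intro haar_integral_translate[OF m, symmetric] continuous_intros b(1) b'(1))
    also have "\<dots> = (LINT \<omega>|m. (b a * cnj (b' a)) * (b \<omega> * cnj (b' \<omega>)))"
      by (simp add: b(3) b'(3) mult_ac)
    also have "\<dots> = (b a * cnj (b' a)) * ?I" by simp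
    finally have "(b a * cnj (b' a) - 1) * ?I = 0" by (simp add: algebra_simps)
    moreover have "b a * cnj (b' a) \<noteq> 1"
    proof
      assume "b a * cnj (b' a) = 1"
      then have "b a * (b' a * cnj (b' a)) = b' a" by (simp add: mult_ac)
      then show False using a by (simp add: inv)
    qed
    ultimately show ?thesis using False by simp
  qed
qed

lemma gaussian_orthonormal:
  assumes "independent_standard_gaussians P g"
  shows "infinite_orthonormal_system P (gaussian_system g)"
proof -
  interpret prob_space P using assms by (simp add: independent_standard_gaussians_def)
  have ind: "indep_vars (\<lambda>_. borel) g UNIV" and D: "distributed P lborel (g i) std_normal_density" for i
    using assms by (auto simp: independent_standard_gaussians_def)
  have [measurable]: "g i \<in> borel_measurable P" for i
    using distributed_measurable[OF D[of i]] by simp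
  have sq: "integrable P (\<lambda>\<omega>. (g i \<omega>)\<^sup>2)" for i
    using distributed_integrable[OF D[of i], of "\<lambda>x. x\<^sup>2"] integrable_std_normal_moment[of 2]
    by simp
  have id: "integrable P (g i)" for i
    using distributed_integrable[OF D[of i], of "\<lambda>x. x"] integrable_std_normal_moment[of 1]
    by simp
  have mean: "expectation (g i) = 0" for i
    using standard_normal_distributed_expectation[OF D[of i]] .
  have var: "expectation (\<lambda>\<omega>. (g i \<omega>)\<^sup>2) = 1" for i
    using standard_normal_distributed_variance[OF D[of i]] by (simp add: mean)
  have ort: "expectation (\<lambda>\<omega>. g i \<omega> * g j \<omega>) = 0" if "i \<noteq> j" for i j
  proof -
    have "indep_vars (\<lambda>_. borel) g {i, j}" by (rule indep_vars_subset[OF ind]) simp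
    then have "expectation (\<lambda>\<omega>. \<Prod>k\<in>{i, j}. g k \<omega>) = (\<Prod>k\<in>{i, j}. expectation (g k))"
      by (intro indep_vars_lebesgue_integral) (auto simp: id)
    then show ?thesis using that by (simp add: mean)
  qed
  have dist: "g i \<noteq> g j" if "i \<noteq> j" for i j
    using ort[OF that] var[of j] by (auto simp: power2_eq_square)
  have inj: "inj (\<lambda>i \<omega>. complex_of_real (g i \<omega>))"
  proof (rule injI)
    fix i j assume "(\<lambda>\<omega>. complex_of_real (g i \<omega>)) = (\<lambda>\<omega>. complex_of_real (g j \<omega>))"
    then have "g i = g j" by (auto simp: fun_eq_iff)
    then show "i = j" using dist by blast
  qed
  have "(LINT \<omega>|P. complex_of_real (g i \<omega>) * cnj (complex_of_real (g j \<omega>))) = (if i = j then 1 else 0)"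
    for i j
  proof -
    have "(LINT \<omega>|P. complex_of_real (g i \<omega>) * cnj (complex_of_real (g j \<omega>)))
        = complex_of_real (expectation (\<lambda>\<omega>. g i \<omega> * g j \<omega>))"
      by (simp flip: of_real_mult)
    then show ?thesis using var[of j] ort[of i j] by (auto simp: power2_eq_square)
  qed
  moreover have "(\<lambda>\<omega>. complex_of_real (g i \<omega>)) = (\<lambda>\<omega>. complex_of_real (g j \<omega>)) \<longleftrightarrow> i = j" for i j
    using inj_eq[OF inj, of i j] .
  ultimately show ?thesis
    using range_inj_infinite[OF inj] sq
    unfolding infinite_orthonormal_system_def gaussian_system_def by simp
qed

end

(* (a) implies (b): write s for the coordinatewise square function of the x_i. If all L_p norms are
   equivalent on the span of B, then the left-hand side of the summing inequality in l_v^n is, for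
   v < \<infinity>, equivalent to the l_v norm of s, whatever B is; so all such systems have the same limit
   orders. Since l_\<infinity>^n and l_v^n are n^(1/v)-isomorphic, v = \<infinity> follows by letting v grow.

   (b) implies (a): only u = v = \<infinity> is needed, where the Gaussian limit order is 0. The vectors
   x_i = (a_i b_i(t_j))_j bound the L_2 norm of max_j |f(t_j + .)| by \<rho> n^\<epsilon> times the L_2 norm of
   f = sum_i a_i b_i. If |f| > s on a set of measure about 1/n, then suitable translates of this set
   cover half of G; hence the level sets decay like s^(-1/\<epsilon>), and f is in L_p for p < 1/\<epsilon>. *)

theory Submission
  imports Defs
begin

subsection \<open>Weighted power means\<close>

text \<open>The system enters only through scalar sums. Orthonormality fixes their L_2 norms; the
  L_p bounds control them from above and, through L_4, their L_1 norms from below. The passage to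
  l_v^n uses the probability weights |s_j|^v / ||s||_v^v: norms relative to s are compared with
  means over the coordinates, and expectations can be taken one coordinate at a time.

  The constants depend on p in an uncontrolled way, so no uniform estimate reaches v = \<infinity>;
  what saves this case is that an infimum over exponents tolerates a loss n^(1/v) for every finite
  v. The comparison of two systems does not match their members: both are infinite, so any finite
  family of vectors can be attached to distinct members of either.

  In the converse no independence of characters is at hand, and the measure of the set |f| > s has
  to be read off from translates alone; these are found by averaging over Haar measure. Decay of
  order s^(-p) would not yet give a p-th moment, hence the exponent 1/(p+1) instead of 1/p.\<close>

lemma sum_fun_apply: "(\<Sum>i\<in>I. f i) x = (\<Sum>i\<in>I. f i x)"
  by (induction I rule: infinite_finite_induct) auto

lemma powr_weighted_mean_le:
  fixes w h :: "'i \<Rightarrow> real"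
  assumes r: "1 \<le> r" and "finite I" and w: "\<And>i. i \<in> I \<Longrightarrow> 0 \<le> w i" "sum w I = 1"
    and h: "\<And>i. i \<in> I \<Longrightarrow> 0 \<le> h i"
  shows "(\<Sum>i\<in>I. w i * h i) powr r \<le> (\<Sum>i\<in>I. w i * h i powr r)"
proof -
  have "convex_on {0..} (\<lambda>x::real. x powr r)"
  proof (rule convex_onI)
    fix t x y :: real
    assume "0 < t" "t < 1" "x \<in> {0..}" "y \<in> {0..}"
    then show "((1 - t) *\<^sub>R x + t *\<^sub>R y) powr r \<le> (1 - t) * x powr r + t * y powr r"
      using powr_convex_nonneg[OF r, of x y "1 - t" t] by simp
  qed simp
  moreover have "I \<noteq> {}" using w by auto
  ultimately show ?thesis
    using convex_on_sum[OF \<open>finite I\<close>, of "{0..}" "\<lambda>x. x powr r" w h] w h by simp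
qed

text \<open>With \<open>w j = |y j|^v / ||y||^v\<close> the v-th mean of the ratios |z j| / |y j| is
  exactly ||z|| / ||y||; Jensen places it between the first mean and, after taking powers, the p-th
  mean. Both bounds are sums over coordinates, so they commute with expectations.\<close>

lemma lp_norm_weights:
  fixes y :: "nat \<Rightarrow> complex" and v :: real
  assumes v: "1 \<le> v" and A: "0 < lp_norm n v y"
  obtains w :: "nat \<Rightarrow> real" where
    "\<forall>j. 0 \<le> w j" "(\<Sum>j<n. w j) = 1" "\<forall>j. y j = 0 \<longrightarrow> w j = 0"
    "\<forall>z p. (\<forall>j. y j = 0 \<longrightarrow> z j = 0) \<longrightarrow> v \<le> p \<longrightarrow>
       (lp_norm n v z / lp_norm n v y) powr p \<le> (\<Sum>j<n. w j * (cmod (z j) / cmod (y j)) powr p)"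
    "\<forall>z. (\<forall>j. y j = 0 \<longrightarrow> z j = 0) \<longrightarrow>
       (\<Sum>j<n. w j * (cmod (z j) / cmod (y j))) \<le> lp_norm n v z / lp_norm n v y"
proof
  define a where "a = lp_norm n v y"
  define w where "w j = cmod (y j) powr v / a powr v" for j
  have a0: "0 < a" using A by (simp add: a_def)
  have lp: "lp_norm n v f powr v = (\<Sum>j<n. cmod (f j) powr v)" for f
    using v by (simp add: lp_norm_def powr_powr sum_nonneg)
  have w0: "0 \<le> w j" for j by (simp add: w_def)
  then show "\<forall>j. 0 \<le> w j" by simp
  show w1: "(\<Sum>j<n. w j) = 1"
    using lp[of y, symmetric] a0 unfolding w_def by (simp flip: sum_divide_distrib a_def)
  show "\<forall>j. y j = 0 \<longrightarrow> w j = 0" by (simp add: w_def)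
  have *: "(v \<le> p \<longrightarrow> (lp_norm n v z / lp_norm n v y) powr p
        \<le> (\<Sum>j<n. w j * (cmod (z j) / cmod (y j)) powr p)) \<and>
      (\<Sum>j<n. w j * (cmod (z j) / cmod (y j))) \<le> lp_norm n v z / lp_norm n v y"
    if zero: "\<forall>j. y j = 0 \<longrightarrow> z j = 0" for z :: "nat \<Rightarrow> complex" and p
  proof -
    define h where "h j = cmod (z j) / cmod (y j)" for j
    have h0: "0 \<le> h j" for j by (simp add: h_def)
    \<comment> \<open>Where \<open>y j = 0\<close> both sides vanish: the weight is 0 and
      \<open>z j = 0\<close> by assumption, so division by zero does no harm.\<close>
    have wh: "w j * h j powr v = cmod (z j) powr v / a powr v" for j
      using zero by (cases "y j = 0") (auto simp: w_def h_def powr_divide)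
    have N0: "0 \<le> lp_norm n v z" using v by (intro lp_norm_nonneg) simp
    have eq: "(\<Sum>j<n. w j * h j powr v) = (lp_norm n v z / a) powr v"
      using N0 a0 lp[of z] by (simp add: wh powr_divide flip: sum_divide_distrib)
    have pow: "(lp_norm n v z / a) powr p \<le> (\<Sum>j<n. w j * h j powr p)" if "v \<le> p"
    proof -
      \<comment> \<open>Jensen with exponent p/v \<ge> 1, applied to the v-th powers of the
        ratios.\<close>
      have "(lp_norm n v z / a) powr p = ((lp_norm n v z / a) powr v) powr (p / v)"
        using v by (simp add: powr_powr)
      also have "\<dots> \<le> (\<Sum>j<n. w j * (h j powr v) powr (p / v))"
        unfolding eq[symmetric] using v that w0 w1 by (intro powr_weighted_mean_le) auto
      also have "\<dots> = (\<Sum>j<n. w j * h j powr p)" using v by (simp add: powr_powr)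
      finally show ?thesis .
    qed
    have le: "(\<Sum>j<n. w j * h j) powr v \<le> (lp_norm n v z / a) powr v"
      unfolding eq[symmetric] using v w0 w1 h0 by (intro powr_weighted_mean_le) auto
    have le': "((\<Sum>j<n. w j * h j) powr v) powr (1 / v) \<le> ((lp_norm n v z / a) powr v) powr (1 / v)"
      using v by (intro powr_mono2[OF _ _ le]) simp_all
    have "0 \<le> (\<Sum>j<n. w j * h j)" using w0 h0 by (simp add: sum_nonneg)
    with le' have mean: "(\<Sum>j<n. w j * h j) \<le> lp_norm n v z / a"
      using v N0 a0 by (simp add: powr_powr)
    with mean pow show ?thesis by (simp add: a_def h_def)
  qed
  show "\<forall>z p. (\<forall>j. y j = 0 \<longrightarrow> z j = 0) \<longrightarrow> v \<le> p \<longrightarrow>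
       (lp_norm n v z / lp_norm n v y) powr p \<le> (\<Sum>j<n. w j * (cmod (z j) / cmod (y j)) powr p)"
    using * by blast
  show "\<forall>z. (\<forall>j. y j = 0 \<longrightarrow> z j = 0) \<longrightarrow>
       (\<Sum>j<n. w j * (cmod (z j) / cmod (y j))) \<le> lp_norm n v z / lp_norm n v y"
    using * by blast
qed

subsection \<open>Orthonormal systems with bounded moments\<close>

text \<open>The \<Lambda>(p) inequality raised to the power p, with the L_2 norm already evaluated
  as the l_2 norm of the coefficients. Integrability is part of the definition because the integral
  of a non-integrable function is 0, which would make the bound vacuous for unbounded
  systems.\<close>

definition moments_bounded :: "'w measure \<Rightarrow> ('w \<Rightarrow> complex) set \<Rightarrow> real \<Rightarrow> bool" where
  "moments_bounded M B p \<longleftrightarrow> (\<exists>c>0. \<forall>(n::nat) b a. inj_on b {..<n} \<longrightarrow> b ` {..<n} \<subseteq> B \<longrightarrow>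
     integrable M (\<lambda>\<omega>. cmod (\<Sum>i<n. a i * b i \<omega>) powr p) \<and>
     (LINT \<omega>|M. cmod (\<Sum>i<n. a i * b i \<omega>) powr p) \<le> c * sqrt (\<Sum>i<n. (cmod (a i))\<^sup>2) powr p)"

text \<open>Complex-valued so that \<open>lp_norm\<close> applies to it.\<close>

definition square_function :: "nat \<Rightarrow> (nat \<Rightarrow> nat \<Rightarrow> complex) \<Rightarrow> nat \<Rightarrow> complex" where
  "square_function k x j = complex_of_real (sqrt (\<Sum>i<k. (cmod (x i j))\<^sup>2))"

definition B_sum :: "nat \<Rightarrow> (nat \<Rightarrow> 'w \<Rightarrow> complex) \<Rightarrow> (nat \<Rightarrow> nat \<Rightarrow> complex) \<Rightarrow> 'w \<Rightarrow> nat \<Rightarrow> complex" where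
  "B_sum k b x \<omega> = (\<Sum>i<k. scale_fun (b i \<omega>) (x i))"

lemma B_sum_apply: "B_sum k b x \<omega> j = (\<Sum>i<k. x i j * b i \<omega>)"
  by (simp add: B_sum_def sum_fun_apply scale_fun_def mult.commute)

lemma cmod_square_function: "cmod (square_function k x j) = sqrt (\<Sum>i<k. (cmod (x i j))\<^sup>2)"
  by (simp add: square_function_def sum_nonneg)

lemma B_sum_eq_0: "square_function k x j = 0 \<Longrightarrow> B_sum k b x \<omega> j = 0"
  by (simp add: square_function_def sum_nonneg_eq_0_iff B_sum_apply)

locale orthonormal_system = prob_space M for M :: "'w measure" +
  fixes B :: "('w \<Rightarrow> complex) set"
  assumes orthonormal: "infinite_orthonormal_system M B"
begin

lemma measurable_member [measurable]: "b \<in> B \<Longrightarrow> b \<in> borel_measurable M"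
  using orthonormal by (simp add: infinite_orthonormal_system_def)

lemma integrable_member_product:
  assumes "b \<in> B" "b' \<in> B"
  shows "integrable M (\<lambda>\<omega>. b \<omega> * cnj (b' \<omega>))"
proof (rule Bochner_Integration.integrable_bound)
  show "integrable M (\<lambda>\<omega>. (cmod (b \<omega>))\<^sup>2 + (cmod (b' \<omega>))\<^sup>2)"
    using assms orthonormal by (simp add: infinite_orthonormal_system_def)
  have [measurable]: "b \<in> borel_measurable M" "b' \<in> borel_measurable M"
    using assms by (auto intro: measurable_member)
  show "(\<lambda>\<omega>. b \<omega> * cnj (b' \<omega>)) \<in> borel_measurable M"
    by (intro borel_measurable_times measurable_compose[OF _ borel_measurable_continuous_onI[of cnj]])
      (auto intro: continuous_intros)
  have "cmod (b \<omega>) * cmod (b' \<omega>) \<le> (cmod (b \<omega>))\<^sup>2 + (cmod (b' \<omega>))\<^sup>2" for \<omega>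
    using sum_squares_bound[of "cmod (b \<omega>)" "cmod (b' \<omega>)"]
      mult_nonneg_nonneg[OF norm_ge_zero norm_ge_zero, of "b \<omega>" "b' \<omega>"] by linarith
  then show "AE \<omega> in M. norm (b \<omega> * cnj (b' \<omega>)) \<le> norm ((cmod (b \<omega>))\<^sup>2 + (cmod (b' \<omega>))\<^sup>2)"
    by (simp add: norm_mult)
qed

lemma parseval:
  fixes n :: nat
  assumes "inj_on b {..<n}" "b ` {..<n} \<subseteq> B"
  shows "integrable M (\<lambda>\<omega>. (cmod (\<Sum>i<n. a i * b i \<omega>))\<^sup>2)"
    and "(LINT \<omega>|M. (cmod (\<Sum>i<n. a i * b i \<omega>))\<^sup>2) = (\<Sum>i<n. (cmod (a i))\<^sup>2)"
proof -
  have eq: "complex_of_real ((cmod (\<Sum>i<n. a i * b i \<omega>))\<^sup>2)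
      = (\<Sum>i<n. \<Sum>j<n. (a i * cnj (a j)) * (b i \<omega> * cnj (b j \<omega>)))" for \<omega>
    by (simp only: complex_norm_square sum_product cnj_sum complex_cnj_mult) (simp add: mult_ac)
  have int: "integrable M (\<lambda>\<omega>. complex_of_real ((cmod (\<Sum>i<n. a i * b i \<omega>))\<^sup>2))"
    unfolding eq using assms
    by (intro Bochner_Integration.integrable_sum integrable_mult_right integrable_member_product) auto
  show "integrable M (\<lambda>\<omega>. (cmod (\<Sum>i<n. a i * b i \<omega>))\<^sup>2)"
    using integrable_Re[OF int] by simp
  have "complex_of_real (LINT \<omega>|M. (cmod (\<Sum>i<n. a i * b i \<omega>))\<^sup>2)
      = (LINT \<omega>|M. complex_of_real ((cmod (\<Sum>i<n. a i * b i \<omega>))\<^sup>2))"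
    by (rule integral_complex_of_real[symmetric])
  also have "\<dots> = (\<Sum>i<n. \<Sum>j<n. (a i * cnj (a j)) * (LINT \<omega>|M. b i \<omega> * cnj (b j \<omega>)))"
    unfolding eq using assms
    by (subst Bochner_Integration.integral_sum;
        (intro Bochner_Integration.integrable_sum integrable_mult_right integrable_member_product)?)
      (auto intro!: sum.cong Bochner_Integration.integral_sum[THEN trans]
        integrable_mult_right integrable_member_product)
  also have "\<dots> = (\<Sum>i<n. \<Sum>j<n. if j = i then complex_of_real ((cmod (a i))\<^sup>2) else 0)"
  proof (intro sum.cong refl)
    fix i j assume ij: "i \<in> {..<n}" "j \<in> {..<n}"
    then have "b i \<in> B" "b j \<in> B" "b i = b j \<longleftrightarrow> j = i" using assms by (auto simp: inj_on_def)
    then show "(a i * cnj (a j)) * (LINT \<omega>|M. b i \<omega> * cnj (b j \<omega>))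
        = (if j = i then complex_of_real ((cmod (a i))\<^sup>2) else 0)"
      using orthonormal by (simp add: infinite_orthonormal_system_def complex_norm_square[symmetric])
  qed
  also have "\<dots> = complex_of_real (\<Sum>i<n. (cmod (a i))\<^sup>2)" by simp
  finally show "(LINT \<omega>|M. (cmod (\<Sum>i<n. a i * b i \<omega>))\<^sup>2) = (\<Sum>i<n. (cmod (a i))\<^sup>2)"
    by (simp only: of_real_eq_iff)
qed

lemma measurable_B_sum:
  assumes "b ` {..<k} \<subseteq> B"
  shows "(\<lambda>\<omega>. B_sum k b x \<omega> j) \<in> borel_measurable M"
  unfolding B_sum_apply using assms by (intro borel_measurable_sum borel_measurable_times) auto

text \<open>On n coordinates every l_u norm is dominated by a multiple of the l_1 norm;
  Cauchy-Schwarz then leaves a sum of squared coordinates, integrable by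
  \<open>parseval\<close>.\<close>

lemma integrable_lp_norm_B_sum:
  assumes u: "1 \<le> u" and b: "inj_on b {..<k}" "b ` {..<k} \<subseteq> B"
  shows "integrable M (\<lambda>\<omega>. (lp_norm n u (B_sum k b x \<omega>))\<^sup>2)"
    and "integrable M (\<lambda>\<omega>. lp_norm n u (B_sum k b x \<omega>))"
proof -
  note [measurable] = measurable_B_sum[OF b(2)]
  have meas: "(\<lambda>\<omega>. lp_norm n u (B_sum k b x \<omega>)) \<in> borel_measurable M"
  proof (cases "u = \<infinity>")
    case True
    \<comment> \<open>The dummy index \<open>n\<close> supplies the \<open>0\<close> inserted in
      \<open>lp_norm\<close> and keeps the family nonempty when \<open>n = 0\<close>.\<close>
    have "(\<lambda>\<omega>. Max ((\<lambda>j. if j = n then 0 else cmod (B_sum k b x \<omega> j)) ` {..n})) \<in> borel_measurable M"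
      by (rule borel_measurable_Max) (auto intro: measurable)
    moreover have "(\<lambda>j. if j = n then 0 else cmod (B_sum k b x \<omega> j)) ` {..n}
        = insert 0 ((\<lambda>j. cmod (B_sum k b x \<omega> j)) ` {..<n})" for \<omega>
      by (auto simp: image_iff)
    ultimately show ?thesis using True by (simp add: lp_norm_def)
  next
    case False
    then show ?thesis by (simp add: lp_norm_def)
  qed
  show sq: "integrable M (\<lambda>\<omega>. (lp_norm n u (B_sum k b x \<omega>))\<^sup>2)"
  proof (rule Bochner_Integration.integrable_bound)
    show "integrable M (\<lambda>\<omega>. (real n)\<^sup>2 * (real n * (\<Sum>j<n. (cmod (B_sum k b x \<omega> j))\<^sup>2)))"
      unfolding B_sum_apply by (intro integrable_mult_right Bochner_Integration.integrable_sum parseval b)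
    have "(lp_norm n u z)\<^sup>2 \<le> (real n)\<^sup>2 * (real n * (\<Sum>j<n. (cmod (z j))\<^sup>2))" for z
    proof -
      have "(lp_norm n u z)\<^sup>2 \<le> (real n * (\<Sum>j<n. cmod (z j)))\<^sup>2"
        using lp_norm_le_sum[OF u] lp_norm_nonneg[OF u] by (rule power_mono)
      also have "\<dots> \<le> (real n)\<^sup>2 * (real n * (\<Sum>j<n. (cmod (z j))\<^sup>2))"
        using sum_squared_le_sum_of_squares[of "\<lambda>j. cmod (z j)" "{..<n}"]
        by (simp add: power_mult_distrib mult_left_mono mult.commute)
      finally show ?thesis .
    qed
    then show "AE \<omega> in M. norm ((lp_norm n u (B_sum k b x \<omega>))\<^sup>2)
        \<le> norm ((real n)\<^sup>2 * (real n * (\<Sum>j<n. (cmod (B_sum k b x \<omega> j))\<^sup>2)))"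
      by (simp add: sum_nonneg abs_mult)
  qed (use meas in simp)
  show "integrable M (\<lambda>\<omega>. lp_norm n u (B_sum k b x \<omega>))"
    using meas sq by (rule square_integrable_imp_integrable)
qed

end

section \<open>Random sums in l_v^n and their square functions\<close>

lemma lp_norm_eq_0:
  assumes "1 \<le> u" "\<And>j. j < n \<Longrightarrow> z j = 0"
  shows "lp_norm n u z = 0"
  using lp_norm_le_sum[OF assms(1), of n z] lp_norm_nonneg[OF assms(1), of n z] assms(2) by simp

text \<open>The common abstraction of Gaussian variables and of characters satisfying (a): one
  comparison theorem, applied in both directions, then yields (b).\<close>

locale lacunary_system = orthonormal_system +
  assumes moments: "2 < p \<Longrightarrow> moments_bounded M B p"
begin

text \<open>Splitting at \<open>t = A\<close> gives \<open>t\<^sup>2 \<le> A t + t\<^sup>4 / A\<^sup>2\<close>; with \<open>A\<^sup>2\<close> of the order of the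
  variance the fourth moment is absorbed.\<close>

lemma first_moment_lower_bound:
  obtains \<kappa> where "0 < \<kappa>"
    "\<And>(k::nat) b a. inj_on b {..<k} \<Longrightarrow> b ` {..<k} \<subseteq> B \<Longrightarrow>
       \<kappa> * sqrt (\<Sum>i<k. (cmod (a i))\<^sup>2) \<le> expectation (\<lambda>\<omega>. cmod (\<Sum>i<k. a i * b i \<omega>))"
proof -
  obtain c where c: "0 < c" and *: "\<And>(n::nat) b a. inj_on b {..<n} \<Longrightarrow> b ` {..<n} \<subseteq> B \<Longrightarrow>
     integrable M (\<lambda>\<omega>. cmod (\<Sum>i<n. a i * b i \<omega>) powr 4) \<and>
     (LINT \<omega>|M. cmod (\<Sum>i<n. a i * b i \<omega>) powr 4) \<le> c * sqrt (\<Sum>i<n. (cmod (a i))\<^sup>2) powr 4"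
    using moments[of 4] unfolding moments_bounded_def by auto
  define \<kappa> where "\<kappa> = 1 / (2 * sqrt (2 * c))"
  show thesis
  proof
    show "0 < \<kappa>" using c by (simp add: \<kappa>_def)
    fix k :: nat and a :: "nat \<Rightarrow> complex" and b :: "nat \<Rightarrow> 'a \<Rightarrow> complex"
    assume b: "inj_on b {..<k}" "b ` {..<k} \<subseteq> B"
    define X where "X \<omega> = cmod (\<Sum>i<k. a i * b i \<omega>)" for \<omega>
    define \<sigma> where "\<sigma> = sqrt (\<Sum>i<k. (cmod (a i))\<^sup>2)"
    have \<sigma>0: "0 \<le> \<sigma>" by (simp add: \<sigma>_def sum_nonneg)
    have X0: "0 \<le> X \<omega>" for \<omega> by (simp add: X_def)
    have [measurable]: "(\<lambda>\<omega>. \<Sum>i<k. a i * b i \<omega>) \<in> borel_measurable M"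
      using b by (intro borel_measurable_sum borel_measurable_times) auto
    have [measurable]: "X \<in> borel_measurable M" unfolding X_def by measurable
    have int2: "integrable M (\<lambda>\<omega>. (X \<omega>)\<^sup>2)" and E2: "expectation (\<lambda>\<omega>. (X \<omega>)\<^sup>2) = \<sigma>\<^sup>2"
      using parseval[OF b, of a] by (simp_all add: X_def \<sigma>_def sum_nonneg)
    have int1: "integrable M X" by (rule square_integrable_imp_integrable[OF _ int2]) simp
    have int4: "integrable M (\<lambda>\<omega>. X \<omega> ^ 4)" and E4: "expectation (\<lambda>\<omega>. X \<omega> ^ 4) \<le> c * \<sigma> ^ 4"
      using *[OF b, of a] \<sigma>0 X0 by (simp_all add: X_def \<sigma>_def sum_nonneg powr_numeral)
    show "\<kappa> * sqrt (\<Sum>i<k. (cmod (a i))\<^sup>2) \<le> expectation (\<lambda>\<omega>. cmod (\<Sum>i<k. a i * b i \<omega>))"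
    proof (cases "\<sigma> = 0")
      case True
      then show ?thesis using X0 by (simp add: \<sigma>_def)
    next
      case False
      \<comment> \<open>Chosen so that c \<sigma>^4 / A^2 is exactly half the variance. What remains
        is \<sigma>^2 / 2 \<le> A E X, and division by \<sigma> produces the value of
        \<open>\<kappa>\<close>.\<close>
      define A where "A = sqrt (2 * c) * \<sigma>"
      have A: "0 < A" "A\<^sup>2 = 2 * c * \<sigma>\<^sup>2"
        using False \<sigma>0 c by (simp_all add: A_def power_mult_distrib)
      have split: "t\<^sup>2 \<le> A * t + t ^ 4 / A\<^sup>2" if "0 \<le> t" for t
      proof (cases "t \<le> A")
        case True
        have "t\<^sup>2 \<le> A * t" using True that by (simp add: power2_eq_square mult_right_mono)
        moreover have "0 \<le> t ^ 4 / A\<^sup>2" by simp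
        ultimately show ?thesis by linarith
      next
        case False
        have "A\<^sup>2 * t\<^sup>2 \<le> t\<^sup>2 * t\<^sup>2" using False A by (intro mult_right_mono power_mono) auto
        then have "t\<^sup>2 * A\<^sup>2 \<le> t ^ 4"
          by (simp add: power2_eq_square power4_eq_xxxx mult_ac)
        then have "t\<^sup>2 \<le> t ^ 4 / A\<^sup>2" using A(1) by (simp add: pos_le_divide_eq)
        moreover have "0 \<le> A * t" using A that by simp
        ultimately show ?thesis by linarith
      qed
      have "\<sigma>\<^sup>2 \<le> expectation (\<lambda>\<omega>. A * X \<omega> + X \<omega> ^ 4 / A\<^sup>2)"
        unfolding E2[symmetric] using int1 int2 int4 X0 by (intro integral_mono split) auto
      also have "\<dots> = A * expectation X + expectation (\<lambda>\<omega>. X \<omega> ^ 4) / A\<^sup>2"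
        using int1 int4 by simp
      also have "\<dots> \<le> A * expectation X + c * \<sigma> ^ 4 / A\<^sup>2"
        using E4 by (intro add_left_mono divide_right_mono) auto
      also have "c * \<sigma> ^ 4 / A\<^sup>2 = \<sigma>\<^sup>2 / 2"
        using c False unfolding A by (simp add: power2_eq_square power4_eq_xxxx)
      finally have "\<sigma>\<^sup>2 / 2 \<le> A * expectation X" by simp
      then have "\<sigma> * \<sigma> \<le> (2 * sqrt (2 * c) * expectation X) * \<sigma>"
        by (simp add: A_def power2_eq_square mult_ac)
      then have "\<sigma> \<le> 2 * sqrt (2 * c) * expectation X" using False \<sigma>0 by simp
      then have "\<kappa> * \<sigma> \<le> expectation X"
        using c by (simp add: \<kappa>_def pos_divide_le_eq mult.commute)
      then show ?thesis by (simp add: \<sigma>_def X_def[abs_def])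
    qed
  qed
qed

text \<open>After scaling by the norm \<open>A\<close> of the square function, t^2 \<le> 1 + t^p
  trades the second moment for a p-th one. The weights split the latter into coordinates, each
  contributing at most \<open>c\<close> times its weight; since the weights sum to 1, the constant
  depends neither on \<open>n\<close> nor on \<open>k\<close>.\<close>

lemma square_function_upper_bound:
  fixes v :: real
  assumes v: "1 \<le> v"
  obtains C where "0 < C"
    "\<And>n k b x. inj_on b {..<k} \<Longrightarrow> b ` {..<k} \<subseteq> B \<Longrightarrow>
       sqrt (expectation (\<lambda>\<omega>. (lp_norm n v (B_sum k b x \<omega>))\<^sup>2)) \<le> C * lp_norm n v (square_function k x)"
proof -
  \<comment> \<open>Large enough for both uses: p > 2 for the moment bound, p \<ge> v for the
    convexity step.\<close>
  define p where "p = v + 2"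
  have p: "2 < p" "v \<le> p" using v by (simp_all add: p_def)
  obtain c where c: "0 < c" and *: "\<And>(n::nat) b a. inj_on b {..<n} \<Longrightarrow> b ` {..<n} \<subseteq> B \<Longrightarrow>
     integrable M (\<lambda>\<omega>. cmod (\<Sum>i<n. a i * b i \<omega>) powr p) \<and>
     (LINT \<omega>|M. cmod (\<Sum>i<n. a i * b i \<omega>) powr p) \<le> c * sqrt (\<Sum>i<n. (cmod (a i))\<^sup>2) powr p"
    using moments[OF p(1)] unfolding moments_bounded_def by auto
  show thesis
  proof
    show "0 < sqrt (1 + c)" using c by simp
    fix n k :: nat and b :: "nat \<Rightarrow> 'a \<Rightarrow> complex" and x :: "nat \<Rightarrow> nat \<Rightarrow> complex"
    assume b: "inj_on b {..<k}" "b ` {..<k} \<subseteq> B"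
    define y where "y = square_function k x"
    define z where "z = B_sum k b x"
    define A where "A = lp_norm n v y"
    have zero: "z \<omega> j = 0" if "y j = 0" for \<omega> j
      using that by (simp add: y_def z_def B_sum_eq_0)
    have v': "1 \<le> ereal v" using v by simp
    have A0: "0 \<le> A" unfolding A_def using v' by (rule lp_norm_nonneg)
    have int: "integrable M (\<lambda>\<omega>. (lp_norm n v (z \<omega>))\<^sup>2)"
      unfolding z_def using v' b by (rule integrable_lp_norm_B_sum)
    have intp: "integrable M (\<lambda>\<omega>. cmod (z \<omega> j) powr p)"
      and Ep: "expectation (\<lambda>\<omega>. cmod (z \<omega> j) powr p) \<le> c * cmod (y j) powr p" for j
      using *[OF b, of "\<lambda>i. x i j"] by (simp_all add: z_def y_def B_sum_apply cmod_square_function)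
    have "sqrt (expectation (\<lambda>\<omega>. (lp_norm n v (z \<omega>))\<^sup>2)) \<le> sqrt (1 + c) * A"
    proof (cases "A = 0")
      case True
      then have "y j = 0" if "j < n" for j
        using cmod_le_lp_norm[OF v' that, of y] by (simp add: A_def)
      then have "lp_norm n v (z \<omega>) = 0" for \<omega> using v' by (intro lp_norm_eq_0) (auto intro: zero)
      then show ?thesis using True by simp
    next
      case False
      then have A: "0 < A" using A0 by simp
      obtain w where w: "\<forall>j. 0 \<le> w j" "(\<Sum>j<n. w j) = 1" "\<forall>j. y j = 0 \<longrightarrow> w j = 0"
        and le: "\<forall>z p. (\<forall>j. y j = 0 \<longrightarrow> z j = 0) \<longrightarrow> v \<le> p \<longrightarrow>
          (lp_norm n v z / lp_norm n v y) powr p \<le> (\<Sum>j<n. w j * (cmod (z j) / cmod (y j)) powr p)"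
        and "\<forall>z. (\<forall>j. y j = 0 \<longrightarrow> z j = 0) \<longrightarrow>
           (\<Sum>j<n. w j * (cmod (z j) / cmod (y j))) \<le> lp_norm n v z / lp_norm n v y"
        by (rule lp_norm_weights[OF v A[unfolded A_def]]) (rule that)
      have pw: "(lp_norm n v (z \<omega>))\<^sup>2
          \<le> A\<^sup>2 * (1 + (\<Sum>j<n. w j / cmod (y j) powr p * cmod (z \<omega> j) powr p))" for \<omega>
      proof -
        define t where "t = lp_norm n v (z \<omega>) / A"
        have t: "0 \<le> t" using A lp_norm_nonneg[OF v'] by (simp add: t_def)
        have "t\<^sup>2 \<le> 1 + t powr p"
        proof (cases "t \<le> 1")
          case True
          then have "t\<^sup>2 \<le> 1" using t by (simp add: power_le_one)
          then show ?thesis by (simp add: add_increasing2)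
        next
          case False
          then have "t powr 2 \<le> t powr p" using p by (intro powr_mono) auto
          then show ?thesis using False by (simp add: powr_numeral)
        qed
        also have "t powr p \<le> (\<Sum>j<n. w j * (cmod (z \<omega> j) / cmod (y j)) powr p)"
          unfolding t_def A_def using p by (intro le[rule_format] zero)
        also have "\<dots> = (\<Sum>j<n. w j / cmod (y j) powr p * cmod (z \<omega> j) powr p)"
          by (simp add: powr_divide)
        finally have "A\<^sup>2 * t\<^sup>2 \<le> A\<^sup>2 * (1 + (\<Sum>j<n. w j / cmod (y j) powr p * cmod (z \<omega> j) powr p))"
          by (intro mult_left_mono) auto
        then show ?thesis using A by (simp add: t_def power_divide)
      qed
      have "expectation (\<lambda>\<omega>. (lp_norm n v (z \<omega>))\<^sup>2)
          \<le> expectation (\<lambda>\<omega>. A\<^sup>2 * (1 + (\<Sum>j<n. w j / cmod (y j) powr p * cmod (z \<omega> j) powr p)))"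
        using int intp by (intro integral_mono pw) auto
      also have "\<dots> = A\<^sup>2 * (1 + (\<Sum>j<n. w j / cmod (y j) powr p * expectation (\<lambda>\<omega>. cmod (z \<omega> j) powr p)))"
        using intp by (simp add: prob_space)
      also have "\<dots> \<le> A\<^sup>2 * (1 + (\<Sum>j<n. w j * c))"
      proof (intro mult_left_mono add_left_mono sum_mono)
        fix j
        show "w j / cmod (y j) powr p * expectation (\<lambda>\<omega>. cmod (z \<omega> j) powr p) \<le> w j * c"
        proof (cases "y j = 0")
          case False
          have "w j / cmod (y j) powr p * expectation (\<lambda>\<omega>. cmod (z \<omega> j) powr p)
              \<le> w j / cmod (y j) powr p * (c * cmod (y j) powr p)"
            using w(1) Ep by (intro mult_left_mono) auto
          then show ?thesis using False by simp
        qed (use w(3) in simp)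
      qed simp
      also have "\<dots> = A\<^sup>2 * (1 + c)" by (simp add: w(2) flip: sum_distrib_right)
      finally have "sqrt (expectation (\<lambda>\<omega>. (lp_norm n v (z \<omega>))\<^sup>2)) \<le> sqrt (A\<^sup>2 * (1 + c))"
        by (rule real_sqrt_le_mono)
      then show ?thesis using A by (simp add: real_sqrt_mult mult.commute)
    qed
    then show "sqrt (expectation (\<lambda>\<omega>. (lp_norm n v (B_sum k b x \<omega>))\<^sup>2))
        \<le> sqrt (1 + c) * lp_norm n v (square_function k x)"
      by (simp add: z_def A_def y_def)
  qed
qed

text \<open>The second moment dominates the square of the first, because a variance is nonnegative.
  The first moment of the norm dominates a weighted mean of the first moments of the coordinates,
  and each of these is bounded below by \<open>first_moment_lower_bound\<close>.\<close>

lemma square_function_lower_bound: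
  fixes v :: real
  assumes v: "1 \<le> v"
  obtains \<kappa> where "0 < \<kappa>"
    "\<And>n k b x. inj_on b {..<k} \<Longrightarrow> b ` {..<k} \<subseteq> B \<Longrightarrow>
       \<kappa> * lp_norm n v (square_function k x) \<le> sqrt (expectation (\<lambda>\<omega>. (lp_norm n v (B_sum k b x \<omega>))\<^sup>2))"
proof -
  obtain \<kappa> where \<kappa>: "0 < \<kappa>" and *: "\<And>(k::nat) b a. inj_on b {..<k} \<Longrightarrow> b ` {..<k} \<subseteq> B \<Longrightarrow>
       \<kappa> * sqrt (\<Sum>i<k. (cmod (a i))\<^sup>2) \<le> expectation (\<lambda>\<omega>. cmod (\<Sum>i<k. a i * b i \<omega>))"
    using first_moment_lower_bound by blast
  show thesis
  proof
    show "0 < \<kappa>" by fact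
    fix n k :: nat and b :: "nat \<Rightarrow> 'a \<Rightarrow> complex" and x :: "nat \<Rightarrow> nat \<Rightarrow> complex"
    assume b: "inj_on b {..<k}" "b ` {..<k} \<subseteq> B"
    define y where "y = square_function k x"
    define z where "z = B_sum k b x"
    define A where "A = lp_norm n v y"
    have zero: "z \<omega> j = 0" if "y j = 0" for \<omega> j
      using that by (simp add: y_def z_def B_sum_eq_0)
    have v': "1 \<le> ereal v" using v by simp
    have A0: "0 \<le> A" unfolding A_def using v' by (rule lp_norm_nonneg)
    have int: "integrable M (\<lambda>\<omega>. (lp_norm n v (z \<omega>))\<^sup>2)" "integrable M (\<lambda>\<omega>. lp_norm n v (z \<omega>))"
      unfolding z_def using integrable_lp_norm_B_sum[OF v' b] by auto
    have sq: "expectation (\<lambda>\<omega>. lp_norm n v (z \<omega>)) \<le> sqrt (expectation (\<lambda>\<omega>. (lp_norm n v (z \<omega>))\<^sup>2))"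
    proof (rule real_le_rsqrt)
      show "(expectation (\<lambda>\<omega>. lp_norm n v (z \<omega>)))\<^sup>2 \<le> expectation (\<lambda>\<omega>. (lp_norm n v (z \<omega>))\<^sup>2)"
        using variance_positive[of "\<lambda>\<omega>. lp_norm n v (z \<omega>)"] variance_eq[OF int(2,1)] by simp
    qed
    have intj: "integrable M (\<lambda>\<omega>. cmod (z \<omega> j))" for j
    proof (rule square_integrable_imp_integrable)
      show "(\<lambda>\<omega>. cmod (z \<omega> j)) \<in> borel_measurable M"
        unfolding z_def using measurable_B_sum[OF b(2)] by measurable
      show "integrable M (\<lambda>\<omega>. (cmod (z \<omega> j))\<^sup>2)"
        unfolding z_def B_sum_apply by (intro parseval b)
    qed
    have "\<kappa> * A \<le> sqrt (expectation (\<lambda>\<omega>. (lp_norm n v (z \<omega>))\<^sup>2))"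
    proof (cases "A = 0")
      case False
      then have A: "0 < A" using A0 by simp
      obtain w where w: "\<forall>j. 0 \<le> w j" "(\<Sum>j<n. w j) = 1" "\<forall>j. y j = 0 \<longrightarrow> w j = 0"
        and "\<forall>z p. (\<forall>j. y j = 0 \<longrightarrow> z j = 0) \<longrightarrow> v \<le> p \<longrightarrow>
          (lp_norm n v z / lp_norm n v y) powr p \<le> (\<Sum>j<n. w j * (cmod (z j) / cmod (y j)) powr p)"
        and le: "\<forall>z. (\<forall>j. y j = 0 \<longrightarrow> z j = 0) \<longrightarrow>
           (\<Sum>j<n. w j * (cmod (z j) / cmod (y j))) \<le> lp_norm n v z / lp_norm n v y"
        by (rule lp_norm_weights[OF v A[unfolded A_def]]) (rule that)
      have "\<kappa> = (\<Sum>j<n. w j * \<kappa>)" by (simp add: w(2) flip: sum_distrib_right)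
      also have "\<dots> \<le> (\<Sum>j<n. w j / cmod (y j) * expectation (\<lambda>\<omega>. cmod (z \<omega> j)))"
      proof (rule sum_mono)
        fix j
        show "w j * \<kappa> \<le> w j / cmod (y j) * expectation (\<lambda>\<omega>. cmod (z \<omega> j))"
        proof (cases "y j = 0")
          case False
          have "\<kappa> * cmod (y j) \<le> expectation (\<lambda>\<omega>. cmod (z \<omega> j))"
            using *[OF b, of "\<lambda>i. x i j"] by (simp add: z_def y_def B_sum_apply cmod_square_function)
          then have "w j / cmod (y j) * (\<kappa> * cmod (y j))
              \<le> w j / cmod (y j) * expectation (\<lambda>\<omega>. cmod (z \<omega> j))"
            using w(1) by (intro mult_left_mono) auto
          then show ?thesis using False by simp
        qed (use w(3) in simp)
      qed
      also have "\<dots> = expectation (\<lambda>\<omega>. \<Sum>j<n. w j * (cmod (z \<omega> j) / cmod (y j)))"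
        using intj by simp
      also have "\<dots> \<le> expectation (\<lambda>\<omega>. lp_norm n v (z \<omega>) / A)"
        unfolding A_def using intj int by (intro integral_mono le[rule_format] zero) auto
      also have "\<dots> = expectation (\<lambda>\<omega>. lp_norm n v (z \<omega>)) / A" by simp
      finally have "\<kappa> * A \<le> expectation (\<lambda>\<omega>. lp_norm n v (z \<omega>))"
        using A by (simp add: field_simps)
      then show ?thesis using sq by simp
    qed simp
    then show "\<kappa> * lp_norm n v (square_function k x)
        \<le> sqrt (expectation (\<lambda>\<omega>. (lp_norm n v (B_sum k b x \<omega>))\<^sup>2))"
      by (simp add: z_def A_def y_def)
  qed
qed

end

subsection \<open>Summing norms of the identity and limit exponents\<close>

definition weak_l2_norm :: "nat \<Rightarrow> ereal \<Rightarrow> nat \<Rightarrow> (nat \<Rightarrow> nat \<Rightarrow> complex) \<Rightarrow> real" where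
  "weak_l2_norm n u k x = (SUP \<phi>\<in>dual_ball (lp_space n u). sqrt (\<Sum>i<k. (cmod (\<phi> (x i)))\<^sup>2))"

lemma bounded_operator_id:
  assumes u: "1 \<le> u" and v: "1 \<le> v"
  shows "bounded_operator (lp_space n u) (lp_space n v) id"
proof -
  have "lp_norm n v x \<le> (real n * real n) * lp_norm n u x" for x
  proof -
    have "lp_norm n v x \<le> real n * (\<Sum>i<n. cmod (x i))" using v by (rule lp_norm_le_sum)
    also have "\<dots> \<le> real n * (\<Sum>i<n. lp_norm n u x)"
      using u by (intro mult_left_mono sum_mono cmod_le_lp_norm) auto
    finally show ?thesis by simp
  qed
  then show ?thesis by (auto simp: bounded_operator_def lp_space_def)
qed

lemma B_summing_with_id_iff:
  assumes "1 \<le> u" "1 \<le> v"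
  shows "B_summing_with M B (lp_space n u) (lp_space n v) id c \<longleftrightarrow>
    (\<forall>k b x. inj_on b {..<k} \<longrightarrow> b ` {..<k} \<subseteq> B \<longrightarrow> x ` {..<k} \<subseteq> points (lp_space n u) \<longrightarrow>
       sqrt (LINT \<omega>|M. (lp_norm n v (B_sum k b x \<omega>))\<^sup>2) \<le> c * weak_l2_norm n u k x)"
  using bounded_operator_id[OF assms]
  by (auto simp: B_summing_with_def weak_l2_norm_def B_sum_def lp_space_def)

lemma B_summing_with_mono:
  assumes "B_summing_with M B E F T c" and c: "0 < c" "c \<le> d"
  shows "B_summing_with M B E F T d"
  unfolding B_summing_with_def
proof (intro conjI allI impI)
  show "bounded_operator E F T" using assms(1) by (simp add: B_summing_with_def)
  fix n :: nat and b x
  assume bx: "inj_on b {..<n} \<and> b ` {..<n} \<subseteq> B \<and> x ` {..<n} \<subseteq> points E"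
  let ?W = "SUP \<phi>\<in>dual_ball E. sqrt (\<Sum>i<n. (cmod (\<phi> (x i)))\<^sup>2)"
  let ?I = "LINT \<omega>|M. (nrm F (\<Sum>i<n. cscale F (b i \<omega>) (T (x i))))\<^sup>2"
  have le: "sqrt ?I \<le> c * ?W" using assms(1) bx by (simp add: B_summing_with_def)
  \<comment> \<open>The constant may be enlarged only if \<open>?W\<close> is nonnegative. Its sign
    is read off from the inequality itself: the left side is nonnegative and \<open>c\<close> is
    positive.\<close>
  have "0 \<le> sqrt ?I" by (intro real_sqrt_ge_zero integral_nonneg_AE) simp
  then have "0 \<le> c * ?W" using le by (rule order_trans)
  then have "0 \<le> ?W" using c(1) by (simp only: zero_le_mult_iff) linarith
  then have "c * ?W \<le> d * ?W" using c(2) by (rule mult_right_mono[rotated])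
  with le show "sqrt ?I \<le> d * ?W" by linarith
qed

text \<open>The exponents competing in \<open>limit_order\<close>, with the bound imposed as a
  constant in the summing inequality instead of on the infimum \<open>pi_summing\<close>.\<close>

definition limit_exponents ::
  "'w measure \<Rightarrow> ('w \<Rightarrow> complex) set \<Rightarrow> ereal \<Rightarrow> ereal \<Rightarrow> real set" where
  "limit_exponents M B u v = {l. 0 < l \<and> (\<exists>\<rho>>0. \<forall>n\<ge>1.
     B_summing_with M B (lp_space n u) (lp_space n v) id (\<rho> * real n powr l))}"

lemma pi_summing_le:
  assumes "0 < c" "B_summing_with M B E F T c"
  shows "pi_summing M B E F T \<le> ereal c"
  unfolding pi_summing_def using assms by (intro INF_lower) auto

text \<open>The factor 2 takes care of the infimum, which need not be attained a priori.\<close>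

lemma B_summing_with_pi_summing:
  assumes "0 < r" "pi_summing M B E F T \<le> ereal r"
  shows "B_summing_with M B E F T (2 * r)"
proof -
  have "pi_summing M B E F T < ereal (2 * r)"
    using assms by (intro le_less_trans[OF assms(2)]) simp
  then obtain c where c: "0 < c" "B_summing_with M B E F T c" "c < 2 * r"
    unfolding pi_summing_def by (auto simp: INF_less_iff)
  show ?thesis by (rule B_summing_with_mono[OF c(2,1) less_imp_le[OF c(3)]])
qed

text \<open>Passing between the infimum and an actual constant costs a factor 2, which
  \<open>\<rho>\<close> absorbs without changing the exponent.\<close>

lemma limit_order_eq_INF:
  "limit_order (pi_summing M B) u v = (INF l\<in>limit_exponents M B u v. ereal l)"
proof -
  have "(\<exists>\<rho>>0. \<forall>n\<ge>1. pi_summing M B (lp_space n u) (lp_space n v) id \<le> ereal (\<rho> * real n powr l)) \<longleftrightarrow>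
      (\<exists>\<rho>>0. \<forall>n\<ge>1. B_summing_with M B (lp_space n u) (lp_space n v) id (\<rho> * real n powr l))" for l
  proof safe
    fix \<rho> :: real
    assume \<rho>: "0 < \<rho>"
      "\<forall>n\<ge>1. pi_summing M B (lp_space n u) (lp_space n v) id \<le> ereal (\<rho> * real n powr l)"
    have "B_summing_with M B (lp_space n u) (lp_space n v) id (2 * \<rho> * real n powr l)" if "1 \<le> n" for n
      unfolding mult.assoc using \<rho> that by (intro B_summing_with_pi_summing) auto
    then show "\<exists>\<rho>>0. \<forall>n\<ge>1. B_summing_with M B (lp_space n u) (lp_space n v) id (\<rho> * real n powr l)"
      using \<rho>(1) by (intro exI[of _ "2 * \<rho>"]) auto
  next
    fix \<rho> :: real
    assume \<rho>: "0 < \<rho>"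
      "\<forall>n\<ge>1. B_summing_with M B (lp_space n u) (lp_space n v) id (\<rho> * real n powr l)"
    have "pi_summing M B (lp_space n u) (lp_space n v) id \<le> ereal (\<rho> * real n powr l)" if "1 \<le> n" for n
      using \<rho> that by (intro pi_summing_le) auto
    then show "\<exists>\<rho>>0. \<forall>n\<ge>1. pi_summing M B (lp_space n u) (lp_space n v) id \<le> ereal (\<rho> * real n powr l)"
      using \<rho>(1) by blast
  qed
  then show ?thesis by (simp add: limit_order_def limit_exponents_def)
qed

lemma limit_exponents_mono:
  assumes "l \<in> limit_exponents M B u v" "l \<le> l'"
  shows "l' \<in> limit_exponents M B u v"
proof -
  obtain \<rho> where \<rho>: "0 < \<rho>" and *:
    "\<forall>n\<ge>1. B_summing_with M B (lp_space n u) (lp_space n v) id (\<rho> * real n powr l)"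
    using assms(1) by (auto simp: limit_exponents_def)
  have "B_summing_with M B (lp_space n u) (lp_space n v) id (\<rho> * real n powr l')" if "1 \<le> n" for n
  proof (rule B_summing_with_mono)
    show "B_summing_with M B (lp_space n u) (lp_space n v) id (\<rho> * real n powr l)" using * that by blast
    show "0 < \<rho> * real n powr l" using \<rho> that by simp
    show "\<rho> * real n powr l \<le> \<rho> * real n powr l'"
      using \<rho> assms(2) that by (intro mult_left_mono powr_mono) auto
  qed
  then show ?thesis using assms \<rho> by (auto simp: limit_exponents_def)
qed

text \<open>The set of exponents is upward closed but may omit its infimum, hence the strict
  inequality.\<close>

lemma less_limit_order_imp_mem:
  assumes "limit_order (pi_summing M B) u v < ereal l"
  shows "l \<in> limit_exponents M B u v"
proof -
  obtain l' where "l' \<in> limit_exponents M B u v" "ereal l' < ereal l"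
    using assms unfolding limit_order_eq_INF INF_less_iff by blast
  then show ?thesis using limit_exponents_mono[of l' M B u v l] by simp
qed

section \<open>Exchanging a finite target exponent for the sup norm\<close>

lemma lp_norm_infinity_le: "1 \<le> v \<Longrightarrow> lp_norm n \<infinity> z \<le> lp_norm n v z"
  by (simp add: lp_norm_infinity_le_iff lp_norm_nonneg cmod_le_lp_norm)

lemma lp_norm_le_powr_bound:
  fixes v c :: real
  assumes v: "1 \<le> v" and c: "0 \<le> c" "\<And>j. j < n \<Longrightarrow> cmod (z j) \<le> c"
  shows "lp_norm n v z \<le> real n powr (1 / v) * c"
proof -
  have "(\<Sum>i<n. cmod (z i) powr v) \<le> (\<Sum>i<n. c powr v)"
    using c v by (intro sum_mono powr_mono2) auto
  then have "lp_norm n v z \<le> (real n * c powr v) powr (1 / v)"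
    using v by (auto simp: lp_norm_def intro!: powr_mono2 sum_nonneg)
  also have "\<dots> = real n powr (1 / v) * c" using v c by (simp add: powr_mult powr_powr)
  finally show ?thesis .
qed

lemma lp_norm_le_powr_infinity:
  fixes v :: real
  assumes v: "1 \<le> v"
  shows "lp_norm n v z \<le> real n powr (1 / v) * lp_norm n \<infinity> z"
  using v by (intro lp_norm_le_powr_bound cmod_le_lp_norm lp_norm_nonneg) auto

context orthonormal_system
begin

text \<open>The sup norm lies below the l_v norm, so the same constants serve.\<close>

lemma limit_exponents_finite_imp_infinity:
  assumes u: "1 \<le> u" and v: "1 \<le> v" and l: "l \<in> limit_exponents M B u v"
  shows "l \<in> limit_exponents M B u \<infinity>"
proof -
  have "B_summing_with M B (lp_space n u) (lp_space n \<infinity>) id c"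
    if "B_summing_with M B (lp_space n u) (lp_space n v) id c" for n c
  proof -
    have "sqrt (LINT \<omega>|M. (lp_norm n \<infinity> (B_sum k b x \<omega>))\<^sup>2) \<le> c * weak_l2_norm n u k x"
      if "inj_on b {..<k}" "b ` {..<k} \<subseteq> B" "x ` {..<k} \<subseteq> points (lp_space n u)" for k b x
    proof -
      have "sqrt (LINT \<omega>|M. (lp_norm n \<infinity> (B_sum k b x \<omega>))\<^sup>2)
          \<le> sqrt (LINT \<omega>|M. (lp_norm n v (B_sum k b x \<omega>))\<^sup>2)"
        using v that
        by (intro real_sqrt_le_mono integral_mono integrable_lp_norm_B_sum power_mono
            lp_norm_infinity_le lp_norm_nonneg) auto
      also have "\<dots> \<le> c * weak_l2_norm n u k x"
        using \<open>B_summing_with M B (lp_space n u) (lp_space n v) id c\<close> that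
        by (simp add: B_summing_with_id_iff[OF u v])
      finally show ?thesis .
    qed
    then show ?thesis using u by (simp add: B_summing_with_id_iff)
  qed
  then show ?thesis using l unfolding limit_exponents_def by blast
qed

text \<open>The embedding of the sup norm space into l_v^n has norm at most n^(1/v); this factor is
  the whole loss in the exponent.\<close>

lemma limit_exponents_infinity_imp_finite:
  fixes v :: real
  assumes u: "1 \<le> u" and v: "1 \<le> v" and l: "l \<in> limit_exponents M B u \<infinity>"
  shows "l + 1 / v \<in> limit_exponents M B u v"
proof -
  have v': "1 \<le> ereal v" using v by simp
  have *: "B_summing_with M B (lp_space n u) (lp_space n v) id (real n powr (1 / v) * c)"
    if c: "B_summing_with M B (lp_space n u) (lp_space n \<infinity>) id c" for n c
  proof -
    have "sqrt (LINT \<omega>|M. (lp_norm n v (B_sum k b x \<omega>))\<^sup>2) \<le> real n powr (1 / v) * c * weak_l2_norm n u k x"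
      if b: "inj_on b {..<k}" "b ` {..<k} \<subseteq> B" and x: "x ` {..<k} \<subseteq> points (lp_space n u)" for k b x
    proof -
      have "(LINT \<omega>|M. (lp_norm n v (B_sum k b x \<omega>))\<^sup>2)
          \<le> (LINT \<omega>|M. (real n powr (1 / v))\<^sup>2 * (lp_norm n \<infinity> (B_sum k b x \<omega>))\<^sup>2)"
      proof (rule integral_mono)
        show "integrable M (\<lambda>\<omega>. (lp_norm n v (B_sum k b x \<omega>))\<^sup>2)"
          using v' b by (rule integrable_lp_norm_B_sum)
        show "integrable M (\<lambda>\<omega>. (real n powr (1 / v))\<^sup>2 * (lp_norm n \<infinity> (B_sum k b x \<omega>))\<^sup>2)"
          using b by (intro integrable_mult_right integrable_lp_norm_B_sum) auto
        show "(lp_norm n v (B_sum k b x \<omega>))\<^sup>2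
            \<le> (real n powr (1 / v))\<^sup>2 * (lp_norm n \<infinity> (B_sum k b x \<omega>))\<^sup>2" for \<omega>
          unfolding power_mult_distrib[symmetric] using v v'
          by (intro power_mono lp_norm_le_powr_infinity lp_norm_nonneg) auto
      qed
      then have "sqrt (LINT \<omega>|M. (lp_norm n v (B_sum k b x \<omega>))\<^sup>2)
          \<le> sqrt ((real n powr (1 / v))\<^sup>2 * (LINT \<omega>|M. (lp_norm n \<infinity> (B_sum k b x \<omega>))\<^sup>2))"
        by (intro real_sqrt_le_mono) simp
      also have "\<dots> = real n powr (1 / v) * sqrt (LINT \<omega>|M. (lp_norm n \<infinity> (B_sum k b x \<omega>))\<^sup>2)"
        by (simp add: real_sqrt_mult)
      also have "\<dots> \<le> real n powr (1 / v) * (c * weak_l2_norm n u k x)"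
        using c u b x by (intro mult_left_mono) (auto simp: B_summing_with_id_iff)
      finally show ?thesis by (simp add: mult.assoc)
    qed
    then show ?thesis using u v' by (simp add: B_summing_with_id_iff)
  qed
  obtain \<rho> where \<rho>: "0 < \<rho>" and l0: "0 < l" and le:
    "\<forall>n\<ge>1. B_summing_with M B (lp_space n u) (lp_space n \<infinity>) id (\<rho> * real n powr l)"
    using l by (auto simp: limit_exponents_def)
  have "B_summing_with M B (lp_space n u) (lp_space n v) id (\<rho> * real n powr (l + 1 / v))" if "1 \<le> n" for n
    using *[OF le[rule_format, OF that]] by (simp add: powr_add mult_ac)
  then show ?thesis using \<rho> l0 v by (auto simp: limit_exponents_def add_pos_pos)
qed

end

section \<open>Limit orders of lacunary systems\<close>

context lacunary_system
begin

text \<open>The square function depends on the vectors alone. The upper bound for \<open>B\<close>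
  leads to it, the lower bound for \<open>B'\<close> leads on to a sum over \<open>B'\<close> with
  the same vectors; the weak norm is untouched and the constant grows by C / \<kappa>.\<close>

lemma limit_exponents_subset:
  fixes v :: real
  assumes "lacunary_system M' B'" and u: "1 \<le> u" and v: "1 \<le> v"
  shows "limit_exponents M' B' u v \<subseteq> limit_exponents M B u v"
proof
  interpret M': lacunary_system M' B' by fact
  have v': "1 \<le> ereal v" using v by simp
  obtain C where C: "0 < C" and upper:
    "\<And>n k b x. inj_on b {..<k} \<Longrightarrow> b ` {..<k} \<subseteq> B \<Longrightarrow>
       sqrt (expectation (\<lambda>\<omega>. (lp_norm n v (B_sum k b x \<omega>))\<^sup>2)) \<le> C * lp_norm n v (square_function k x)"
    using square_function_upper_bound[OF v] by blast
  obtain \<kappa> where \<kappa>: "0 < \<kappa>" and lower: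
    "\<And>n k b x. inj_on b {..<k} \<Longrightarrow> b ` {..<k} \<subseteq> B' \<Longrightarrow>
       \<kappa> * lp_norm n v (square_function k x) \<le> sqrt (M'.expectation (\<lambda>\<omega>. (lp_norm n v (B_sum k b x \<omega>))\<^sup>2))"
    using M'.square_function_lower_bound[OF v] by blast
  have *: "B_summing_with M B (lp_space n u) (lp_space n v) id (C / \<kappa> * c)"
    if c: "B_summing_with M' B' (lp_space n u) (lp_space n v) id c" for n c
  proof -
    have "sqrt (expectation (\<lambda>\<omega>. (lp_norm n v (B_sum k b x \<omega>))\<^sup>2)) \<le> C / \<kappa> * c * weak_l2_norm n u k x"
      if b: "inj_on b {..<k}" "b ` {..<k} \<subseteq> B" and x: "x ` {..<k} \<subseteq> points (lp_space n u)" for k b x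
    proof -
      \<comment> \<open>The inequality for \<open>B'\<close> can be tested only on distinct members,
        so \<open>k\<close> of them must exist for every \<open>k\<close>.\<close>
      have "infinite B'" using M'.orthonormal by (simp add: infinite_orthonormal_system_def)
      then obtain b' :: "nat \<Rightarrow> _" where "inj b'" "range b' \<subseteq> B'"
        using infinite_countable_subset by blast
      then have b': "inj_on b' {..<k}" "b' ` {..<k} \<subseteq> B'" by (auto simp: inj_on_def)
      have "sqrt (expectation (\<lambda>\<omega>. (lp_norm n v (B_sum k b x \<omega>))\<^sup>2)) \<le> C * lp_norm n v (square_function k x)"
        using b by (rule upper)
      also have "\<dots> = C / \<kappa> * (\<kappa> * lp_norm n v (square_function k x))" using \<kappa> by simp
      also have "\<dots> \<le> C / \<kappa> * (c * weak_l2_norm n u k x)"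
      proof (rule mult_left_mono)
        have "\<kappa> * lp_norm n v (square_function k x)
            \<le> sqrt (M'.expectation (\<lambda>\<omega>. (lp_norm n v (B_sum k b' x \<omega>))\<^sup>2))"
          using b' by (rule lower)
        also have "\<dots> \<le> c * weak_l2_norm n u k x"
          using c b' x by (simp add: B_summing_with_id_iff[OF u v'])
        finally show "\<kappa> * lp_norm n v (square_function k x) \<le> c * weak_l2_norm n u k x" .
      qed (use C \<kappa> in simp)
      finally show ?thesis by simp
    qed
    then show ?thesis by (simp add: B_summing_with_id_iff[OF u v'])
  qed
  fix l assume "l \<in> limit_exponents M' B' u v"
  then obtain \<rho> where \<rho>: "0 < \<rho>" and l0: "0 < l" and le:
    "\<forall>n\<ge>1. B_summing_with M' B' (lp_space n u) (lp_space n v) id (\<rho> * real n powr l)"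
    by (auto simp: limit_exponents_def)
  have "B_summing_with M B (lp_space n u) (lp_space n v) id (C / \<kappa> * \<rho> * real n powr l)" if "1 \<le> n" for n
    using *[OF le[rule_format, OF that]] by (simp add: mult_ac)
  moreover have "0 < C / \<kappa> * \<rho>" using C \<kappa> \<rho> by simp
  ultimately show "l \<in> limit_exponents M B u v" using l0 unfolding limit_exponents_def by blast
qed

lemma limit_order_le:
  assumes M': "lacunary_system M' B'" and u: "1 \<le> u" and v: "1 \<le> v"
  shows "limit_order (pi_summing M B) u v \<le> limit_order (pi_summing M' B') u v"
  using v
proof (cases rule: exponent_cases)
  case 1
  interpret M': lacunary_system M' B' by fact
  show ?thesis unfolding limit_order_eq_INF
  proof (rule INF_greatest)
    fix l assume l: "l \<in> limit_exponents M' B' u v"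
    \<comment> \<open>From the sup norm to l_r at cost 1/r within \<open>B'\<close>, across to
      \<open>B\<close> by the square function, and back to the sup norm at no cost.\<close>
    have "l + 1 / r \<in> limit_exponents M B u \<infinity>" if r: "1 \<le> r" for r
    proof -
      have "l + 1 / r \<in> limit_exponents M' B' u r"
        using M'.limit_exponents_infinity_imp_finite u r l 1 by blast
      then have "l + 1 / r \<in> limit_exponents M B u r"
        using limit_exponents_subset[OF M' u r] by blast
      then show ?thesis using limit_exponents_finite_imp_infinity[OF u, of "ereal r"] r by simp
    qed
    then have le: "(INF l\<in>limit_exponents M B u \<infinity>. ereal l) \<le> ereal (l + 1 / r)" if "1 \<le> r" for r
      using that by (intro INF_lower)
    have "(\<lambda>n. ereal (l + 1 / real (Suc n))) \<longlonglongrightarrow> ereal (l + 0)"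
      by (intro tendsto_intros LIMSEQ_Suc[OF lim_1_over_n])
    then have "(INF l\<in>limit_exponents M B u \<infinity>. ereal l) \<le> ereal (l + 0)"
      by (rule LIMSEQ_le_const) (use le in auto)
    then show "(INF l\<in>limit_exponents M B u v. ereal l) \<le> ereal l" using 1 by simp
  qed
next
  case (2 p)
  then show ?thesis unfolding limit_order_eq_INF
    using limit_exponents_subset[OF M' u, of p] by (intro INF_superset_mono) auto
qed

text \<open>Coordinate functionals belong to the dual ball of l_\<infinity>^n, so every entry of the
  square function is at most the weak norm, and its l_v norm is at most n^(1/v) times that. Hence
  1/v is an admissible exponent for every finite v.\<close>

lemma limit_order_infinity_infinity: "limit_order (pi_summing M B) \<infinity> \<infinity> \<le> 0"
proof -
  have mem: "1 / v \<in> limit_exponents M B \<infinity> \<infinity>" if v: "1 \<le> v" for v :: real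
  proof -
    have v': "1 \<le> ereal v" using v by simp
    obtain C where C: "0 < C" and upper:
      "\<And>n k b x. inj_on b {..<k} \<Longrightarrow> b ` {..<k} \<subseteq> B \<Longrightarrow>
         sqrt (expectation (\<lambda>\<omega>. (lp_norm n v (B_sum k b x \<omega>))\<^sup>2)) \<le> C * lp_norm n v (square_function k x)"
      using square_function_upper_bound[OF v] by blast
    have "B_summing_with M B (lp_space n \<infinity>) (lp_space n v) id (C * real n powr (1 / v))" for n
    proof -
      have "sqrt (expectation (\<lambda>\<omega>. (lp_norm n v (B_sum k b x \<omega>))\<^sup>2))
          \<le> C * real n powr (1 / v) * weak_l2_norm n \<infinity> k x"
        if b: "inj_on b {..<k}" "b ` {..<k} \<subseteq> B" and x: "x ` {..<k} \<subseteq> points (lp_space n \<infinity>)" for k b x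
      proof -
        \<comment> \<open>A real supremum is an upper bound only for a set bounded above; the l_2
          norm of the numbers ||x_i|| provides the bound.\<close>
        have ub: "sqrt (\<Sum>i<k. (cmod (\<phi> (x i)))\<^sup>2) \<le> weak_l2_norm n \<infinity> k x"
          if "\<phi> \<in> dual_ball (lp_space n \<infinity>)" for \<phi>
          unfolding weak_l2_norm_def
        proof (rule cSUP_upper[OF that], rule bdd_aboveI2)
          fix \<psi> assume "\<psi> \<in> dual_ball (lp_space n \<infinity>)"
          then show "sqrt (\<Sum>i<k. (cmod (\<psi> (x i)))\<^sup>2) \<le> sqrt (\<Sum>i<k. (lp_norm n \<infinity> (x i))\<^sup>2)"
            using x by (intro real_sqrt_le_mono sum_mono power_mono) (auto simp: dual_ball_def lp_space_def)
        qed
        have coord: "(\<lambda>z. z j) \<in> dual_ball (lp_space n \<infinity>)" if "j < n" for j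
          using cmod_le_lp_norm[of \<infinity> j n] that
          by (auto simp: dual_ball_def bounded_operator_def lp_space_def complex_line_def scale_fun_def
              intro!: exI[of _ 1])
        \<comment> \<open>Gives nonnegativity of the weak norm also for \<open>n = 0\<close>, where
          there are no coordinate functionals.\<close>
        have zero: "(\<lambda>z. 0) \<in> dual_ball (lp_space n \<infinity>)"
          by (auto simp: dual_ball_def bounded_operator_def lp_space_def complex_line_def lp_norm_nonneg
              intro!: exI[of _ 0])
        have W0: "0 \<le> weak_l2_norm n \<infinity> k x" using ub[OF zero] by simp
        have "lp_norm n v (square_function k x) \<le> real n powr (1 / v) * weak_l2_norm n \<infinity> k x"
          using v W0 ub[OF coord]
          by (intro lp_norm_le_powr_bound) (auto simp: cmod_square_function)
        then have "C * lp_norm n v (square_function k x) \<le> C * (real n powr (1 / v) * weak_l2_norm n \<infinity> k x)"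
          using C by (intro mult_left_mono) auto
        then show ?thesis using upper[OF b, of n x] by simp
      qed
      then show ?thesis using v' by (simp add: B_summing_with_id_iff)
    qed
    then have "1 / v \<in> limit_exponents M B \<infinity> v" using C v by (auto simp: limit_exponents_def)
    with _ v' show ?thesis by (rule limit_exponents_finite_imp_infinity) simp
  qed
  have le: "limit_order (pi_summing M B) \<infinity> \<infinity> \<le> ereal (1 / v)" if "1 \<le> v" for v
    unfolding limit_order_eq_INF using mem[OF that] by (rule INF_lower)
  have "(\<lambda>n. ereal (1 / real (Suc n))) \<longlonglongrightarrow> ereal 0"
    by (intro tendsto_intros LIMSEQ_Suc[OF lim_1_over_n])
  then have "limit_order (pi_summing M B) \<infinity> \<infinity> \<le> ereal 0"
    by (rule LIMSEQ_le_const) (use le in auto)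
  then show ?thesis by (simp add: zero_ereal_def)
qed

end

subsection \<open>Gaussian variables\<close>

lemma powr_le_one_plus_power:
  fixes t p :: real
  assumes "0 \<le> t" "0 \<le> p" "p \<le> real n"
  shows "t powr p \<le> 1 + t ^ n"
proof (cases "t \<le> 1")
  case True
  then have "t powr p \<le> 1" using assms by (simp add: powr_le1)
  then show ?thesis using assms by (simp add: add_increasing2)
next
  case False
  then have "t powr p \<le> t powr real n" using assms by (intro powr_mono) auto
  then show ?thesis using False by (simp add: powr_realpow)
qed

text \<open>A combination of independent standard Gaussians is normal with standard deviation
  \<open>s\<close>, the l_2 norm of the coefficients. After division by \<open>s\<close> only a
  moment of one standard Gaussian is left, and |t|^p \<le> 1 + t^(2r) reduces it to an even integer
  moment.\<close>

lemma gaussian_sum_moment: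
  assumes P: "independent_standard_gaussians P g" and p: "0 < p"
  obtains c where "0 < c"
    "\<And>J (a :: nat \<Rightarrow> real). finite J \<Longrightarrow> integrable P (\<lambda>\<omega>. \<bar>\<Sum>j\<in>J. a j * g j \<omega>\<bar> powr p) \<and>
       (LINT \<omega>|P. \<bar>\<Sum>j\<in>J. a j * g j \<omega>\<bar> powr p) \<le> c * sqrt (\<Sum>j\<in>J. (a j)\<^sup>2) powr p"
proof -
  interpret prob_space P using P by (simp add: independent_standard_gaussians_def)
  have ind: "indep_vars (\<lambda>_. borel) g UNIV" and D: "distributed P lborel (g i) std_normal_density" for i
    using P by (auto simp: independent_standard_gaussians_def)
  obtain r :: nat where "p \<le> real r" using real_arch_simple by blast
  then have r: "p \<le> real (2 * r)" by simp
  define c where "c = 1 + (LBINT x. std_normal_density x * x ^ (2 * r))"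
  have c: "0 < c" unfolding c_def by (intro add_pos_nonneg integral_nonneg_AE) auto
  show thesis
  proof (rule that[OF c])
    fix J :: "nat set" and a :: "nat \<Rightarrow> real"
    assume J: "finite J"
    \<comment> \<open>Zero coefficients are dropped because the summands must be normal with
      positive standard deviation.\<close>
    define I where "I = {j\<in>J. a j \<noteq> 0}"
    define X where "X \<omega> = (\<Sum>j\<in>I. a j * g j \<omega>)" for \<omega>
    define s where "s = sqrt (\<Sum>j\<in>I. \<bar>a j\<bar>\<^sup>2)"
    have X: "(\<Sum>j\<in>J. a j * g j \<omega>) = X \<omega>" for \<omega>
      unfolding X_def I_def using J by (intro sum.mono_neutral_right) auto
    have s: "sqrt (\<Sum>j\<in>J. (a j)\<^sup>2) = s"
      unfolding s_def I_def using J by (intro arg_cong[of _ _ sqrt] sum.mono_neutral_cong_right) auto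
    show "integrable P (\<lambda>\<omega>. \<bar>\<Sum>j\<in>J. a j * g j \<omega>\<bar> powr p) \<and>
       (LINT \<omega>|P. \<bar>\<Sum>j\<in>J. a j * g j \<omega>\<bar> powr p) \<le> c * sqrt (\<Sum>j\<in>J. (a j)\<^sup>2) powr p"
    proof (cases "I = {}")
      case True
      then have "X \<omega> = 0" for \<omega> by (simp add: X_def)
      then show ?thesis unfolding X using c by simp
    next
      case False
      have I: "finite I" using J by (simp add: I_def)
      have s0: "0 < s" unfolding s_def using False I
        by (intro real_sqrt_gt_zero sum_pos) (auto simp: I_def)
      have "indep_vars (\<lambda>_. borel) (\<lambda>j \<omega>. a j * g j \<omega>) I"
        by (intro indep_vars_compose2[OF indep_vars_subset[OF ind]]) auto
      moreover have "distributed P lborel (\<lambda>\<omega>. a j * g j \<omega>) (normal_density 0 \<bar>a j\<bar>)" if "j \<in> I" for j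
        using normal_density_affine[OF D[of j], of "a j" 0] that by (simp add: I_def)
      ultimately have "distributed P lborel X (normal_density (\<Sum>j\<in>I. 0) s)"
        unfolding X_def[abs_def] s_def using I False by (intro sum_indep_normal) (auto simp: I_def)
      then have Z: "distributed P lborel (\<lambda>\<omega>. X \<omega> / s) std_normal_density"
        using normal_density_affine[of X 0 s "1 / s" 0] s0 by simp
      have int: "integrable P (\<lambda>\<omega>. (X \<omega> / s) ^ (2 * r))"
        using distributed_integrable[OF Z, of "\<lambda>x. x ^ (2 * r)"] integrable_std_normal_moment[of "2 * r"]
        by simp
      have E: "expectation (\<lambda>\<omega>. 1 + (X \<omega> / s) ^ (2 * r)) = c"
        using distributed_integral[OF Z, of "\<lambda>x. x ^ (2 * r)"] int by (simp add: c_def prob_space)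
      have le: "\<bar>X \<omega>\<bar> powr p \<le> s powr p * (1 + (X \<omega> / s) ^ (2 * r))" for \<omega>
      proof -
        have "\<bar>X \<omega>\<bar> powr p = s powr p * \<bar>X \<omega> / s\<bar> powr p"
          using s0 by (simp add: powr_divide)
        also have "\<dots> \<le> s powr p * (1 + \<bar>X \<omega> / s\<bar> ^ (2 * r))"
          using p r by (intro mult_left_mono powr_le_one_plus_power) auto
        finally show ?thesis by (simp only: power_mult power2_abs)
      qed
      have [measurable]: "g j \<in> borel_measurable P" for j
        using distributed_measurable[OF D[of j]] by simp
      have intp: "integrable P (\<lambda>\<omega>. \<bar>X \<omega>\<bar> powr p)"
      proof (rule Bochner_Integration.integrable_bound)
        show "integrable P (\<lambda>\<omega>. s powr p * (1 + (X \<omega> / s) ^ (2 * r)))" using int by simp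
        show "(\<lambda>\<omega>. \<bar>X \<omega>\<bar> powr p) \<in> borel_measurable P" unfolding X_def by measurable
        show "AE \<omega> in P. norm (\<bar>X \<omega>\<bar> powr p) \<le> norm (s powr p * (1 + (X \<omega> / s) ^ (2 * r)))"
        proof (rule AE_I2)
          fix \<omega> show "norm (\<bar>X \<omega>\<bar> powr p) \<le> norm (s powr p * (1 + (X \<omega> / s) ^ (2 * r)))"
            using order_trans[OF le[of \<omega>] abs_ge_self] by (simp only: real_norm_def abs_of_nonneg[OF powr_ge_zero])
        qed
      qed
      have "expectation (\<lambda>\<omega>. \<bar>X \<omega>\<bar> powr p) \<le> expectation (\<lambda>\<omega>. s powr p * (1 + (X \<omega> / s) ^ (2 * r)))"
        using intp int by (intro integral_mono le) auto
      also have "\<dots> = c * s powr p" using E by (simp add: mult.commute)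
      finally show ?thesis unfolding X s using intp by simp
    qed
  qed
qed

text \<open>The variables are real, so the real and imaginary parts of the coefficients give two
  real combinations, each covered by \<open>gaussian_sum_moment\<close>.\<close>

lemma gaussian_lacunary:
  assumes P: "independent_standard_gaussians P g"
  shows "lacunary_system P (gaussian_system g)"
proof -
  interpret prob_space P using P by (simp add: independent_standard_gaussians_def)
  have meas [measurable]: "g j \<in> borel_measurable P" for j
    using P distributed_measurable[of P lborel "g j" std_normal_density]
    by (auto simp: independent_standard_gaussians_def)
  have "moments_bounded P (gaussian_system g) p" if p: "2 < p" for p
  proof -
    have "0 < p" using p by simp
    then obtain c where c: "0 < c" and *: "\<And>J (a :: nat \<Rightarrow> real). finite J \<Longrightarrow>
       integrable P (\<lambda>\<omega>. \<bar>\<Sum>j\<in>J. a j * g j \<omega>\<bar> powr p) \<and>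
       (LINT \<omega>|P. \<bar>\<Sum>j\<in>J. a j * g j \<omega>\<bar> powr p) \<le> c * sqrt (\<Sum>j\<in>J. (a j)\<^sup>2) powr p"
      using gaussian_sum_moment[OF P] by blast
    \<comment> \<open>The power 2^p comes from |X| \<le> 2 max(|Re X|, |Im X|), the factor 2 from
      adding the moments of the two parts.\<close>
    define C where "C = 2 powr p * (2 * c)"
    have "integrable P (\<lambda>\<omega>. cmod (\<Sum>i<n. a i * b i \<omega>) powr p) \<and>
       expectation (\<lambda>\<omega>. cmod (\<Sum>i<n. a i * b i \<omega>) powr p) \<le> C * sqrt (\<Sum>i<n. (cmod (a i))\<^sup>2) powr p"
      if b: "inj_on b {..<n}" "b ` {..<n} \<subseteq> gaussian_system g"
      for n :: nat and b and a :: "nat \<Rightarrow> complex"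
    proof -
      \<comment> \<open>The functions \<open>b i\<close> are translated back into Gaussian indices
        \<open>k i\<close>; these are distinct since the \<open>b i\<close> are, and
        \<open>h\<close> carries the coefficients along.\<close>
      have "\<forall>i\<in>{..<n}. \<exists>j. b i = (\<lambda>\<omega>. complex_of_real (g j \<omega>))"
        using b(2) by (auto simp: gaussian_system_def)
      then obtain k where k: "\<And>i. i < n \<Longrightarrow> b i = (\<lambda>\<omega>. complex_of_real (g (k i) \<omega>))"
        by (metis lessThan_iff)
      have inj: "inj_on k {..<n}" using b(1) k by (auto simp: inj_on_def)
      define J where "J = k ` {..<n}"
      define h where "h j = a (the_inv_into {..<n} k j)" for j
      have h: "h (k i) = a i" if "i < n" for i
        using that inj by (simp add: h_def the_inv_into_f_f)
      have J: "finite J" by (simp add: J_def)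
      define X where "X \<omega> = (\<Sum>i<n. a i * b i \<omega>)" for \<omega>
      have X: "X \<omega> = (\<Sum>j\<in>J. h j * complex_of_real (g j \<omega>))" for \<omega>
        unfolding J_def X_def using inj by (subst sum.reindex) (auto simp: h k intro!: sum.cong)
      define s where "s = sqrt (\<Sum>i<n. (cmod (a i))\<^sup>2)"
      have s: "s = sqrt (\<Sum>j\<in>J. (cmod (h j))\<^sup>2)"
        unfolding J_def s_def using inj by (subst sum.reindex) (auto simp: h intro!: sum.cong)
      define R where "R \<omega> = \<bar>\<Sum>j\<in>J. Re (h j) * g j \<omega>\<bar> powr p" for \<omega>
      define I where "I \<omega> = \<bar>\<Sum>j\<in>J. Im (h j) * g j \<omega>\<bar> powr p" for \<omega>
      have le: "cmod (X \<omega>) powr p \<le> 2 powr p * (R \<omega> + I \<omega>)" for \<omega>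
      proof -
        define x where "x = \<bar>Re (X \<omega>)\<bar>"
        define y where "y = \<bar>Im (X \<omega>)\<bar>"
        have xy: "0 \<le> x" "0 \<le> y" by (simp_all add: x_def y_def)
        have "cmod (X \<omega>) powr p \<le> (2 * max x y) powr p"
          using cmod_le[of "X \<omega>"] p by (intro powr_mono2) (auto simp: x_def y_def)
        also have "\<dots> = 2 powr p * max x y powr p" using xy by (simp add: powr_mult)
        also have "max x y powr p \<le> x powr p + y powr p" by (simp add: max_def)
        finally show ?thesis by (simp add: x_def y_def X R_def I_def)
      qed
      have R: "integrable P R" "expectation R \<le> c * s powr p"
      proof -
        have "sqrt (\<Sum>j\<in>J. (Re (h j))\<^sup>2) \<le> s"
          unfolding s using abs_Re_le_cmod by (intro real_sqrt_le_mono sum_mono) (simp add: abs_le_square_iff[symmetric])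
        then have "sqrt (\<Sum>j\<in>J. (Re (h j))\<^sup>2) powr p \<le> s powr p"
          using p by (intro powr_mono2) (auto intro: sum_nonneg)
        then have "c * sqrt (\<Sum>j\<in>J. (Re (h j))\<^sup>2) powr p \<le> c * s powr p"
          using c by simp
        then show "integrable P R" "expectation R \<le> c * s powr p"
          using *[OF J, of "\<lambda>j. Re (h j)"] unfolding R_def[abs_def] by auto
      qed
      have I: "integrable P I" "expectation I \<le> c * s powr p"
      proof -
        have "sqrt (\<Sum>j\<in>J. (Im (h j))\<^sup>2) \<le> s"
          unfolding s using abs_Im_le_cmod by (intro real_sqrt_le_mono sum_mono) (simp add: abs_le_square_iff[symmetric])
        then have "sqrt (\<Sum>j\<in>J. (Im (h j))\<^sup>2) powr p \<le> s powr p"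
          using p by (intro powr_mono2) (auto intro: sum_nonneg)
        then have "c * sqrt (\<Sum>j\<in>J. (Im (h j))\<^sup>2) powr p \<le> c * s powr p"
          using c by simp
        then show "integrable P I" "expectation I \<le> c * s powr p"
          using *[OF J, of "\<lambda>j. Im (h j)"] unfolding I_def[abs_def] by auto
      qed
      have int: "integrable P (\<lambda>\<omega>. cmod (X \<omega>) powr p)"
      proof (rule Bochner_Integration.integrable_bound)
        show "integrable P (\<lambda>\<omega>. 2 powr p * (R \<omega> + I \<omega>))" using R I by simp
        show "(\<lambda>\<omega>. cmod (X \<omega>) powr p) \<in> borel_measurable P" unfolding X by measurable
        show "AE \<omega> in P. norm (cmod (X \<omega>) powr p) \<le> norm (2 powr p * (R \<omega> + I \<omega>))"
        proof (rule AE_I2)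
          fix \<omega> show "norm (cmod (X \<omega>) powr p) \<le> norm (2 powr p * (R \<omega> + I \<omega>))"
            using order_trans[OF le[of \<omega>] abs_ge_self] by (simp only: real_norm_def abs_of_nonneg[OF powr_ge_zero])
        qed
      qed
      have "expectation (\<lambda>\<omega>. cmod (X \<omega>) powr p) \<le> expectation (\<lambda>\<omega>. 2 powr p * (R \<omega> + I \<omega>))"
        using int R I by (intro integral_mono le) auto
      also have "\<dots> = 2 powr p * (expectation R + expectation I)" using R I by simp
      also have "\<dots> \<le> 2 powr p * (c * s powr p + c * s powr p)"
        using R I by (intro mult_left_mono add_mono) auto
      finally show ?thesis using int by (simp add: X_def s_def C_def)
    qed
    moreover have "0 < C" using c by (simp add: C_def)
    ultimately show ?thesis unfolding moments_bounded_def by blast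
  qed
  then show ?thesis
    by unfold_locales (auto intro: gaussian_orthonormal[OF P])
qed

subsection \<open>Characters\<close>

lemma span_scale_fun_sum:
  assumes "b ` {..<k} \<subseteq> L"
  shows "(\<lambda>\<omega>. \<Sum>i<k. a i * b i \<omega>) \<in> module.span scale_fun L"
proof -
  interpret vector_space "scale_fun :: complex \<Rightarrow> ('a \<Rightarrow> complex) \<Rightarrow> _" by (rule vector_space_scale_fun)
  have "(\<lambda>\<omega>. \<Sum>i<k. a i * b i \<omega>) = (\<Sum>i<k. scale_fun (a i) (b i))"
    by (simp add: fun_eq_iff sum_fun_apply scale_fun_def)
  also have "\<dots> \<in> span L" using assms by (intro span_sum span_scale span_base) auto
  finally show ?thesis .
qed

lemma span_scale_fun_obtain:
  assumes "f \<in> module.span scale_fun L"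
  obtains k :: nat and b and a :: "nat \<Rightarrow> complex"
    where "inj_on b {..<k}" "b ` {..<k} \<subseteq> L" "f = (\<lambda>\<omega>. \<Sum>i<k. a i * b i \<omega>)"
proof -
  interpret vector_space "scale_fun :: complex \<Rightarrow> ('a \<Rightarrow> complex) \<Rightarrow> _" by (rule vector_space_scale_fun)
  obtain T r where T: "finite T" "T \<subseteq> L" and f: "f = (\<Sum>b\<in>T. scale_fun (r b) b)"
    using assms unfolding span_explicit by blast
  obtain b where b: "bij_betw b {..<card T} T"
    using ex_bij_betw_nat_finite[OF T(1)] by (auto simp: lessThan_atLeast0)
  have "f = (\<Sum>i<card T. scale_fun (r (b i)) (b i))"
    unfolding f using sum.reindex_bij_betw[OF b, of "\<lambda>b. scale_fun (r b) b"] by simp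
  then have "f = (\<lambda>\<omega>. \<Sum>i<card T. r (b i) * b i \<omega>)"
    by (simp add: fun_eq_iff sum_fun_apply scale_fun_def)
  with b T show thesis by (intro that[of b "card T" "\<lambda>i. r (b i)"]) (auto simp: bij_betw_def)
qed

locale character_system =
  fixes m :: "'g::topological_ab_group_add measure" and \<Lambda> :: "('g \<Rightarrow> complex) set"
  assumes haar: "normalized_haar_measure m" and chars: "\<Lambda> \<subseteq> characters" and infin: "infinite \<Lambda>"

sublocale character_system \<subseteq> orthonormal_system m \<Lambda>
  using normalized_haar_measureD(2)[OF haar] characters_orthonormal[OF haar chars infin]
  by (simp add: orthonormal_system_def orthonormal_system_axioms_def)

context character_system
begin

lemma cmod_character: "b \<in> \<Lambda> \<Longrightarrow> cmod (b x) = 1"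
  using chars by (auto simp: characters_def)

lemma character_add: "b \<in> \<Lambda> \<Longrightarrow> b (x + y) = b x * b y"
  using chars by (auto simp: characters_def)

lemma space_haar: "space m = UNIV"
  using sets_eq_imp_space_eq[OF normalized_haar_measureD(1)[OF haar]] by (simp only: space_borel)

lemma cmod_character_sum_le:
  assumes "b ` {..<k} \<subseteq> \<Lambda>"
  shows "cmod (\<Sum>i<k. a i * b i \<omega>) \<le> (\<Sum>i<k. cmod (a i))"
  using assms by (intro order_trans[OF norm_sum] sum_mono) (auto simp: norm_mult cmod_character)

lemma measurable_character_sum:
  assumes "b ` {..<k} \<subseteq> \<Lambda>"
  shows "(\<lambda>\<omega>. \<Sum>i<k. a i * b i \<omega>) \<in> borel_measurable m"
  using assms by (intro borel_measurable_sum borel_measurable_times) auto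

lemma integrable_character_sum_powr:
  assumes b: "b ` {..<k} \<subseteq> \<Lambda>" and p: "0 \<le> p"
  shows "integrable m (\<lambda>\<omega>. cmod (\<Sum>i<k. a i * b i \<omega>) powr p)"
proof (rule integrable_const_bound)
  show "AE \<omega> in m. norm (cmod (\<Sum>i<k. a i * b i \<omega>) powr p) \<le> (\<Sum>i<k. cmod (a i)) powr p"
    using cmod_character_sum_le[OF b] p by (intro AE_I2) (auto intro: powr_mono2)
  show "(\<lambda>\<omega>. cmod (\<Sum>i<k. a i * b i \<omega>) powr p) \<in> borel_measurable m"
    using measurable_character_sum[OF b] by measurable
qed

lemma Lp_norm_2_character_sum:
  fixes k :: nat
  assumes "inj_on b {..<k}" "b ` {..<k} \<subseteq> \<Lambda>"
  shows "Lp_norm 2 m (\<lambda>\<omega>. \<Sum>i<k. a i * b i \<omega>) = sqrt (\<Sum>i<k. (cmod (a i))\<^sup>2)"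
  using parseval(2)[OF assms, of a]
  by (simp add: Lp_norm_def powr_half_sqrt sum_nonneg)

text \<open>By Parseval the L_2 norm is the l_2 norm of the coefficients; finite sums of characters
  are bounded, which settles integrability.\<close>

lemma Lambda_p_imp_lacunary:
  assumes "\<And>p. 2 < p \<Longrightarrow> Lambda_p_set m p \<Lambda>"
  shows "lacunary_system m \<Lambda>"
proof unfold_locales
  fix p :: real assume p: "2 < p"
  then obtain c where c: "0 < c" and le: "\<forall>f\<in>module.span scale_fun \<Lambda>. Lp_norm p m f \<le> c * Lp_norm 2 m f"
    using assms by (auto simp: Lambda_p_set_def)
  have "integrable m (\<lambda>\<omega>. cmod (\<Sum>i<n. a i * b i \<omega>) powr p) \<and>
       (LINT \<omega>|m. cmod (\<Sum>i<n. a i * b i \<omega>) powr p) \<le> c powr p * sqrt (\<Sum>i<n. (cmod (a i))\<^sup>2) powr p"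
    if b: "inj_on b {..<n}" "b ` {..<n} \<subseteq> \<Lambda>" for n :: nat and a b
  proof
    show "integrable m (\<lambda>\<omega>. cmod (\<Sum>i<n. a i * b i \<omega>) powr p)"
      using b p by (intro integrable_character_sum_powr) auto
    have "(LINT \<omega>|m. cmod (\<Sum>i<n. a i * b i \<omega>) powr p) = Lp_norm p m (\<lambda>\<omega>. \<Sum>i<n. a i * b i \<omega>) powr p"
      using p by (simp add: Lp_norm_def powr_powr integral_nonneg_AE)
    also have "\<dots> \<le> (c * Lp_norm 2 m (\<lambda>\<omega>. \<Sum>i<n. a i * b i \<omega>)) powr p"
      using le span_scale_fun_sum[OF b(2)] p by (intro powr_mono2) (auto simp: Lp_norm_def)
    also have "\<dots> = c powr p * sqrt (\<Sum>i<n. (cmod (a i))\<^sup>2) powr p"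
      using c by (simp add: Lp_norm_2_character_sum[OF b] powr_mult sum_nonneg)
    finally show "(LINT \<omega>|m. cmod (\<Sum>i<n. a i * b i \<omega>) powr p)
        \<le> c powr p * sqrt (\<Sum>i<n. (cmod (a i))\<^sup>2) powr p" .
  qed
  moreover have "0 < c powr p" using c by simp
  ultimately show "moments_bounded m \<Lambda> p" unfolding moments_bounded_def by blast
qed

end

text \<open>The points are chosen greedily: averaged over \<open>t\<close>, the set \<open>{\<omega>. (\<omega>, t) \<notin> H}\<close> fills at most
  the proportion \<open>1 - \<alpha>\<close> of what the previous points left uncovered.\<close>

lemma (in prob_space) random_covering:
  assumes H: "H \<in> sets (M \<Otimes>\<^sub>M M)"
    and \<alpha>: "\<And>\<omega>. \<omega> \<in> space M \<Longrightarrow> \<alpha> \<le> prob {t\<in>space M. (\<omega>, t) \<in> H}"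
  shows "\<exists>t. (\<forall>j<n. t j \<in> space M) \<and> prob {\<omega>\<in>space M. \<forall>j<n. (\<omega>, t j) \<notin> H} \<le> (1 - \<alpha>) ^ n"
proof (induction n)
  case 0
  then show ?case using prob_space by simp
next
  case (Suc n)
  interpret MM: pair_prob_space M M ..
  note [measurable] = H
  obtain t where t: "\<And>j. j < n \<Longrightarrow> t j \<in> space M"
    and IH: "prob {\<omega>\<in>space M. \<forall>j<n. (\<omega>, t j) \<notin> H} \<le> (1 - \<alpha>) ^ n"
    using Suc.IH by blast
  define V where "V = {\<omega>\<in>space M. \<forall>j<n. (\<omega>, t j) \<notin> H}"
  have slice [measurable]: "{\<omega>\<in>space M. (\<omega>, s) \<notin> H} \<in> sets M" if "s \<in> space M" for s
    using that by measurable
  have V [measurable]: "V \<in> sets M"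
  proof -
    have "V = space M - (\<Union>j<n. space M - {\<omega>\<in>space M. (\<omega>, t j) \<notin> H})" by (auto simp: V_def)
    also have "\<dots> \<in> sets M" using slice t by (intro sets.Diff sets.finite_UN sets.top) auto
    finally show ?thesis .
  qed
  \<comment> \<open>For fixed \<open>s\<close> the integral over \<open>\<omega>\<close> is the
    measure still uncovered once \<open>s\<close> is added; for fixed \<open>\<omega>\<close> in
    \<open>V\<close> the integral over \<open>s\<close> is at most 1 - \<alpha>. Fubini compares the
    two.\<close>
  define F :: "'a \<Rightarrow> 'a \<Rightarrow> real" where "F \<omega> s = indicator V \<omega> * (1 - indicator H (\<omega>, s))" for \<omega> s
  have F01: "0 \<le> F \<omega> s" "F \<omega> s \<le> 1" for \<omega> s by (auto simp: F_def indicator_def)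
  have Fm [measurable]: "(\<lambda>(\<omega>, s). F \<omega> s) \<in> borel_measurable (M \<Otimes>\<^sub>M M)"
    unfolding F_def by measurable
  have Fint: "integrable (M \<Otimes>\<^sub>M M) (\<lambda>(\<omega>, s). F \<omega> s)"
    using F01 by (intro MM.P.integrable_const_bound[where B = 1]) auto
  have psi: "(\<integral>\<omega>. F \<omega> s \<partial>M) = prob (V \<inter> {\<omega>\<in>space M. (\<omega>, s) \<notin> H})" if "s \<in> space M" for s
  proof -
    have "(\<integral>\<omega>. F \<omega> s \<partial>M) = (\<integral>\<omega>. indicator (V \<inter> {\<omega>\<in>space M. (\<omega>, s) \<notin> H}) \<omega> \<partial>M)"
      by (intro Bochner_Integration.integral_cong) (auto simp: F_def indicator_def)
    then show ?thesis using slice[OF that] by simp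
  qed
  have inner: "(\<integral>s. F \<omega> s \<partial>M) \<le> indicator V \<omega> * (1 - \<alpha>)" if w: "\<omega> \<in> space M" for \<omega>
  proof -
    have m: "{s\<in>space M. (\<omega>, s) \<in> H} \<in> sets M" using w by measurable
    have "(\<integral>s. F \<omega> s \<partial>M) = (\<integral>s. indicator V \<omega> * (1 - indicator {s\<in>space M. (\<omega>, s) \<in> H} s) \<partial>M)"
      by (intro Bochner_Integration.integral_cong) (auto simp: F_def indicator_def)
    also have "\<dots> = indicator V \<omega> * (1 - prob {s\<in>space M. (\<omega>, s) \<in> H})"
      using m integrable_real_indicator[OF m] by (simp add: prob_space emeasure_eq_measure)
    also have "\<dots> \<le> indicator V \<omega> * (1 - \<alpha>)" using \<alpha>[OF w] by (intro mult_left_mono) auto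
    finally show ?thesis .
  qed
  have "(\<integral>s. (\<integral>\<omega>. F \<omega> s \<partial>M) \<partial>M) = (\<integral>\<omega>. (\<integral>s. F \<omega> s \<partial>M) \<partial>M)"
    using Fint by (rule MM.Fubini_integral)
  also have "\<dots> \<le> (\<integral>\<omega>. indicator V \<omega> * (1 - \<alpha>) \<partial>M)"
    using MM.integrable_fst[OF Fint] inner integrable_real_indicator[OF V]
    by (intro integral_mono_AE AE_I2) (auto simp: emeasure_eq_measure)
  also have "\<dots> = (1 - \<alpha>) * prob V" by simp
  finally have avg: "(\<integral>s. (\<integral>\<omega>. F \<omega> s \<partial>M) \<partial>M) \<le> (1 - \<alpha>) * prob V" .
  \<comment> \<open>Some point does no worse than the average: were every value above the bound, the
    expectation would be strictly above it too.\<close>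
  have "\<exists>s\<in>space M. (\<integral>\<omega>. F \<omega> s \<partial>M) \<le> (1 - \<alpha>) * prob V"
  proof (rule ccontr)
    assume "\<not> (\<exists>s\<in>space M. (\<integral>\<omega>. F \<omega> s \<partial>M) \<le> (1 - \<alpha>) * prob V)"
    then have "AE s in M. (1 - \<alpha>) * prob V < (\<integral>\<omega>. F \<omega> s \<partial>M)" by (auto simp: not_le)
    with MM.integrable_snd[OF Fint] have "(1 - \<alpha>) * prob V < (\<integral>s. (\<integral>\<omega>. F \<omega> s \<partial>M) \<partial>M)"
      by (rule expectation_greater)
    with avg show False by simp
  qed
  then obtain s where s: "s \<in> space M" "(\<integral>\<omega>. F \<omega> s \<partial>M) \<le> (1 - \<alpha>) * prob V" by blast
  have \<alpha>1: "\<alpha> \<le> 1"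
    using \<alpha>[OF s(1)] prob_le_1 by (rule order_trans)
  have "{\<omega>\<in>space M. \<forall>j<Suc n. (\<omega>, (t(n := s)) j) \<notin> H} = V \<inter> {\<omega>\<in>space M. (\<omega>, s) \<notin> H}"
    by (auto simp: V_def less_Suc_eq)
  then have "prob {\<omega>\<in>space M. \<forall>j<Suc n. (\<omega>, (t(n := s)) j) \<notin> H} \<le> (1 - \<alpha>) * prob V"
    using s psi by simp
  also have "\<dots> \<le> (1 - \<alpha>) * (1 - \<alpha>) ^ n"
    using IH \<alpha>1 by (intro mult_left_mono) (auto simp: V_def)
  finally show ?case using t s by (intro exI[of _ "t(n := s)"]) (auto simp: less_Suc_eq)
qed

section \<open>Level sets of character sums\<close>

text \<open>The term of the highest level 2^i below x majorizes x^p by itself, because x \<le>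
  2^(i+1); the summand 1 serves x \<le> 1. A finite \<open>K\<close> is enough for bounded
  functions.\<close>

lemma dyadic_powr_bound:
  fixes x p :: real
  assumes p: "0 \<le> p" and x: "0 \<le> x" "x \<le> 2 ^ K"
  shows "x powr p \<le> 1 + (\<Sum>i<K. 2 powr (p * real (Suc i)) * (if 2 ^ i < x then 1 else 0))"
  using x(2)
proof (induction K)
  case 0
  then show ?case using x p by (simp add: powr_le1)
next
  case (Suc K)
  show ?case
  proof (cases "x \<le> 2 ^ K")
    case True
    then show ?thesis using Suc.IH by (simp add: sum.lessThan_Suc)
  next
    case False
    have "x powr p \<le> (2 ^ Suc K) powr p" using Suc.prems x p by (intro powr_mono2) auto
    also have "\<dots> = 2 powr (p * real (Suc K))"
      by (subst powr_realpow[symmetric]) (simp_all add: powr_powr mult.commute)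
    finally have "x powr p \<le> 2 powr (p * real (Suc K))" .
    moreover have "0 \<le> (\<Sum>i<K. 2 powr (p * real (Suc i)) * (if 2 ^ i < x then 1 else 0))"
      by (intro sum_nonneg) auto
    ultimately show ?thesis using False by simp
  qed
qed

context character_system
begin

text \<open>Testing the summing inequality on \<open>x\<^sub>i = (a\<^sub>i b\<^sub>i(t\<^sub>j))\<^sub>j\<close> turns the random sum into the vector of
  translates of \<open>f\<close>, while the weak norm stays below \<open>\<parallel>f\<parallel>\<^sub>2\<close>.\<close>

lemma translates_sup_norm_bound:
  fixes k :: nat
  assumes c: "B_summing_with m \<Lambda> (lp_space n \<infinity>) (lp_space n \<infinity>) id c" "0 \<le> c"
    and b: "inj_on b {..<k}" "b ` {..<k} \<subseteq> \<Lambda>"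
    and f: "f = (\<lambda>\<omega>. \<Sum>i<k. a i * b i \<omega>)"
  shows "integrable m (\<lambda>\<omega>. (lp_norm n \<infinity> (\<lambda>j. f (t j + \<omega>)))\<^sup>2)"
    and "(LINT \<omega>|m. (lp_norm n \<infinity> (\<lambda>j. f (t j + \<omega>)))\<^sup>2) \<le> c\<^sup>2 * (\<Sum>i<k. (cmod (a i))\<^sup>2)"
proof -
  \<comment> \<open>Padded with zeros because points of \<open>lp_space\<close> vanish from index
    \<open>n\<close> on.\<close>
  define x where "x i j = (if j < n then a i * b i (t j) else 0)" for i j
  have B: "b i \<in> \<Lambda>" if "i < k" for i using b(2) that by auto
  \<comment> \<open>Multiplicativity of characters: b_i(t_j) b_i(\<omega>) = b_i(t_j +
    \<omega>).\<close>
  have eq: "lp_norm n \<infinity> (B_sum k b x \<omega>) = lp_norm n \<infinity> (\<lambda>j. f (t j + \<omega>))" for \<omega>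
    unfolding lp_norm_def using B
    by (auto simp: f B_sum_apply x_def character_add mult_ac intro!: arg_cong[of _ _ Max] image_cong sum.cong
        arg_cong[of _ _ cmod])
  show "integrable m (\<lambda>\<omega>. (lp_norm n \<infinity> (\<lambda>j. f (t j + \<omega>)))\<^sup>2)"
    using integrable_lp_norm_B_sum(1)[OF _ b, of \<infinity> n x] by (simp add: eq)
  have xp: "x ` {..<k} \<subseteq> points (lp_space n \<infinity>)" by (auto simp: x_def lp_space_def)
  have "weak_l2_norm n \<infinity> k x \<le> sqrt (\<Sum>i<k. (cmod (a i))\<^sup>2)"
    unfolding weak_l2_norm_def
  proof (rule cSUP_least)
    have "(\<lambda>z. 0) \<in> dual_ball (lp_space n \<infinity>)"
      by (auto simp: dual_ball_def bounded_operator_def lp_space_def complex_line_def lp_norm_nonneg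
          intro!: exI[of _ 0])
    then show "dual_ball (lp_space n \<infinity>) \<noteq> {}" by blast
    fix \<phi> assume \<phi>: "\<phi> \<in> dual_ball (lp_space n \<infinity>)"
    \<comment> \<open>Characters have modulus 1, so the sup norm of \<open>x i\<close> is at most
      |a_i|, independently of \<open>n\<close> and of the points \<open>t j\<close>.\<close>
    have "cmod (\<phi> (x i)) \<le> cmod (a i)" if "i < k" for i
    proof -
      have "cmod (\<phi> (x i)) \<le> lp_norm n \<infinity> (x i)"
        using \<phi> xp that by (auto simp: dual_ball_def lp_space_def)
      also have "\<dots> \<le> cmod (a i)"
        using B[OF that] by (simp add: lp_norm_infinity_le_iff x_def norm_mult cmod_character)
      finally show ?thesis .
    qed
    then show "sqrt (\<Sum>i<k. (cmod (\<phi> (x i)))\<^sup>2) \<le> sqrt (\<Sum>i<k. (cmod (a i))\<^sup>2)"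
      by (intro real_sqrt_le_mono sum_mono power_mono) auto
  qed
  then have "c * weak_l2_norm n \<infinity> k x \<le> c * sqrt (\<Sum>i<k. (cmod (a i))\<^sup>2)"
    using c(2) by (rule mult_left_mono)
  moreover have "sqrt (LINT \<omega>|m. (lp_norm n \<infinity> (B_sum k b x \<omega>))\<^sup>2) \<le> c * weak_l2_norm n \<infinity> k x"
    using c(1) b xp by (simp add: B_summing_with_id_iff)
  ultimately have "sqrt (LINT \<omega>|m. (lp_norm n \<infinity> (\<lambda>j. f (t j + \<omega>)))\<^sup>2) \<le> c * sqrt (\<Sum>i<k. (cmod (a i))\<^sup>2)"
    by (simp add: eq)
  then have "(LINT \<omega>|m. (lp_norm n \<infinity> (\<lambda>j. f (t j + \<omega>)))\<^sup>2) \<le> (c * sqrt (\<Sum>i<k. (cmod (a i))\<^sup>2))\<^sup>2"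
    by (rule sqrt_le_D)
  then show "(LINT \<omega>|m. (lp_norm n \<infinity> (\<lambda>j. f (t j + \<omega>)))\<^sup>2) \<le> c\<^sup>2 * (\<Sum>i<k. (cmod (a i))\<^sup>2)"
    by (simp add: power_mult_distrib sum_nonneg)
qed

text \<open>Chebyshev's inequality for the maximum of the translates of f: this maximum exceeds
  \<open>s\<close> on a union of n translates of the level set, and \<open>random_covering\<close>
  picks them so that only a proportion (1 - prob)^n of the group is missed.\<close>

lemma level_set_covering:
  fixes k :: nat
  assumes c: "B_summing_with m \<Lambda> (lp_space n \<infinity>) (lp_space n \<infinity>) id c" "0 \<le> c"
    and b: "inj_on b {..<k}" "b ` {..<k} \<subseteq> \<Lambda>"
    and f: "f = (\<lambda>\<omega>. \<Sum>i<k. a i * b i \<omega>)" and s: "0 < s"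
  shows "s\<^sup>2 * (1 - (1 - prob {\<omega>. s < cmod (f \<omega>)}) ^ n) \<le> c\<^sup>2 * (\<Sum>i<k. (cmod (a i))\<^sup>2)"
proof -
  define H where "H = {z \<in> space (m \<Otimes>\<^sub>M m). s < cmod (f (snd z + fst z))}"
  have sm: "sets m = sets borel" by (rule normalized_haar_measureD(1)[OF haar])
  have fm [measurable]: "f \<in> borel_measurable m" unfolding f by (rule measurable_character_sum[OF b(2)])
  have [measurable]: "b i \<in> borel_measurable m" if "i < k" for i using b(2) that by auto
  have B: "b i \<in> \<Lambda>" if "i < k" for i using b(2) that by auto
  \<comment> \<open>Addition may fail to be measurable for the product sigma-algebra when the group
    is not metrizable. Splitting each character into a product of functions of one variable gives
    measurability of f(t + \<omega>) directly.\<close>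
  have "f (snd z + fst z) = (\<Sum>i<k. a i * b i (snd z) * b i (fst z))" for z
    unfolding f using B by (auto simp: character_add mult_ac intro!: sum.cong)
  moreover have "(\<lambda>z. \<Sum>i<k. a i * b i (snd z) * b i (fst z)) \<in> borel_measurable (m \<Otimes>\<^sub>M m)"
    by (intro borel_measurable_sum) measurable
  ultimately have [measurable]: "(\<lambda>z. f (snd z + fst z)) \<in> borel_measurable (m \<Otimes>\<^sub>M m)" by simp
  have H: "H \<in> sets (m \<Otimes>\<^sub>M m)" unfolding H_def by measurable
  define A where "A = {\<omega>. s < cmod (f \<omega>)}"
  have A: "A \<in> sets m"
  proof -
    have "{\<omega>\<in>space m. s < cmod (f \<omega>)} \<in> sets m" by measurable
    then show ?thesis by (simp add: A_def space_haar)
  qed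
  have "prob A \<le> prob {t\<in>space m. (\<omega>, t) \<in> H}" for \<omega>
  proof -
    \<comment> \<open>Every section of \<open>H\<close> is a translate of \<open>A\<close>, so by
      invariance all sections have the measure of \<open>A\<close>.\<close>
    have "{t\<in>space m. (\<omega>, t) \<in> H} = {t. t + \<omega> \<in> A}"
      by (auto simp: H_def space_pair_measure space_haar A_def)
    also have "\<dots> = (+) (- \<omega>) ` A"
    proof (intro equalityI subsetI)
      fix t assume "t \<in> {t. t + \<omega> \<in> A}"
      then show "t \<in> (+) (- \<omega>) ` A" by (intro image_eqI[of _ _ "t + \<omega>"]) (auto simp: algebra_simps)
    qed (auto simp: algebra_simps)
    finally have "emeasure m {t\<in>space m. (\<omega>, t) \<in> H} = emeasure m A"
      using normalized_haar_measureD(3)[OF haar, of A "- \<omega>"] A sm by simp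
    then show ?thesis by (simp add: measure_def)
  qed
  then obtain t where t: "prob {\<omega>\<in>space m. \<forall>j<n. (\<omega>, t j) \<notin> H} \<le> (1 - prob A) ^ n"
    using random_covering[OF H, of "prob A" n] by blast
  define U where "U = {\<omega>. \<exists>j<n. s < cmod (f (t j + \<omega>))}"
  have U_compl: "{\<omega>\<in>space m. \<forall>j<n. (\<omega>, t j) \<notin> H} = space m - U"
    by (auto simp: U_def H_def space_pair_measure space_haar)
  have "U = (\<Union>j<n. {\<omega>\<in>space m. (\<omega>, t j) \<in> H})"
    by (auto simp: U_def H_def space_pair_measure space_haar)
  also have "\<dots> \<in> sets m"
  proof (intro sets.finite_UN)
    fix j
    have "t j \<in> space m" by (simp add: space_haar)
    note [measurable] = H
    show "{\<omega>\<in>space m. (\<omega>, t j) \<in> H} \<in> sets m" using \<open>t j \<in> space m\<close> by measurable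
  qed simp
  finally have U: "U \<in> sets m" .
  have "1 - (1 - prob A) ^ n \<le> prob U"
    using t prob_compl[OF U] by (simp add: U_compl)
  then have "s\<^sup>2 * (1 - (1 - prob A) ^ n) \<le> s\<^sup>2 * prob U" by (intro mult_left_mono) auto
  also have "\<dots> = (LINT \<omega>|m. s\<^sup>2 * indicator U \<omega>)" using U by simp
  also have "\<dots> \<le> (LINT \<omega>|m. (lp_norm n \<infinity> (\<lambda>j. f (t j + \<omega>)))\<^sup>2)"
  proof (rule integral_mono)
    show "integrable m (\<lambda>\<omega>. s\<^sup>2 * indicator U \<omega>)" using U by (intro integrable_mult_right integrable_real_indicator) (auto simp: emeasure_eq_measure)
    show "integrable m (\<lambda>\<omega>. (lp_norm n \<infinity> (\<lambda>j. f (t j + \<omega>)))\<^sup>2)"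
      by (rule translates_sup_norm_bound[OF c b f])
    show "s\<^sup>2 * indicator U \<omega> \<le> (lp_norm n \<infinity> (\<lambda>j. f (t j + \<omega>)))\<^sup>2" for \<omega>
    proof (cases "\<omega> \<in> U")
      case True
      then obtain j where j: "j < n" "s < cmod (f (t j + \<omega>))" by (auto simp: U_def)
      then have "s \<le> lp_norm n \<infinity> (\<lambda>j. f (t j + \<omega>))"
        using cmod_le_lp_norm[of \<infinity> j n "\<lambda>j. f (t j + \<omega>)"] by simp
      then show ?thesis using True s by (simp add: power_mono)
    qed simp
  qed
  also have "\<dots> \<le> c\<^sup>2 * (\<Sum>i<k. (cmod (a i))\<^sup>2)"
    by (rule translates_sup_norm_bound[OF c b f])
  finally show ?thesis by (simp add: A_def)
qed

text \<open>A level set of measure \<alpha> needs only about 1/\<alpha> translates to cover half of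
  the group, so the bound of order n^l for the maximum becomes one of order \<alpha>^(-l) for
  \<open>s\<close>.\<close>

lemma level_set_decay:
  assumes l: "l \<in> limit_exponents m \<Lambda> \<infinity> \<infinity>"
  obtains D where "0 < D"
    "\<And>(k::nat) b a s. inj_on b {..<k} \<Longrightarrow> b ` {..<k} \<subseteq> \<Lambda> \<Longrightarrow> 0 < (\<Sum>i<k. (cmod (a i))\<^sup>2) \<Longrightarrow> 0 < s \<Longrightarrow>
       prob {\<omega>. s * sqrt (\<Sum>i<k. (cmod (a i))\<^sup>2) < cmod (\<Sum>i<k. a i * b i \<omega>)} \<le> D * s powr (- (1 / l))"
proof -
  obtain \<rho> where \<rho>: "0 < \<rho>" and l0: "0 < l" and sum:
    "\<And>n. 1 \<le> n \<Longrightarrow> B_summing_with m \<Lambda> (lp_space n \<infinity>) (lp_space n \<infinity>) id (\<rho> * real n powr l)"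
    using l by (auto simp: limit_exponents_def)
  \<comment> \<open>Obtained by solving s \<le> 2 \<rho> (2/\<alpha>)^l for \<alpha>.\<close>
  define D where "D = 2 * (2 * \<rho>) powr (1 / l)"
  have D: "0 < D" using \<rho> by (simp add: D_def)
  show thesis
  proof (rule that[OF D])
    fix k :: nat and b :: "nat \<Rightarrow> 'g \<Rightarrow> complex" and a :: "nat \<Rightarrow> complex" and s :: real
    assume b: "inj_on b {..<k}" "b ` {..<k} \<subseteq> \<Lambda>"
      and pos: "0 < (\<Sum>i<k. (cmod (a i))\<^sup>2)" and s: "0 < s"
    define \<sigma> where "\<sigma> = sqrt (\<Sum>i<k. (cmod (a i))\<^sup>2)"
    have \<sigma>: "0 < \<sigma>" "(\<Sum>i<k. (cmod (a i))\<^sup>2) = \<sigma>\<^sup>2" using pos by (simp_all add: \<sigma>_def)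
    define \<alpha> where "\<alpha> = prob {\<omega>. s * \<sigma> < cmod (\<Sum>i<k. a i * b i \<omega>)}"
    have "\<alpha> \<le> D * s powr (- (1 / l))"
    proof (cases "\<alpha> = 0")
      case True
      then show ?thesis using D by simp
    next
      case False
      then have \<alpha>: "0 < \<alpha>" "\<alpha> \<le> 1" by (simp_all add: \<alpha>_def zero_less_measure_iff)
      \<comment> \<open>Rounding up gives n \<alpha> \<ge> 1, hence (1 - \<alpha>)^n \<le> 1/e \<le>
        1/2; since \<alpha> \<le> 1, rounding at most doubles 1/\<alpha>.\<close>
      define n where "n = nat \<lceil>1 / \<alpha>\<rceil>"
      have n: "1 / \<alpha> \<le> real n" "real n \<le> 2 / \<alpha>"
      proof -
        show "1 / \<alpha> \<le> real n" unfolding n_def by (rule real_nat_ceiling_ge)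
        have "real n \<le> 1 / \<alpha> + 1" unfolding n_def using \<alpha> by (simp add: of_nat_nat ceiling_correct)
        also have "\<dots> \<le> 2 / \<alpha>" using \<alpha> by (simp add: field_simps)
        finally show "real n \<le> 2 / \<alpha>" .
      qed
      have n1: "1 \<le> n"
      proof -
        have "0 < 1 / \<alpha>" using \<alpha> by simp
        with n(1) have "0 < real n" by linarith
        then show ?thesis by simp
      qed
      have "(1 - \<alpha>) ^ n \<le> exp (- \<alpha>) ^ n"
        using \<alpha> exp_ge_add_one_self[of "- \<alpha>"] by (intro power_mono) auto
      also have "\<dots> = exp (- (real n * \<alpha>))" by (simp flip: exp_of_nat_mult)
      also have "\<dots> \<le> exp (- 1)" using n(1) \<alpha> by (simp add: field_simps)
      also have "\<dots> \<le> 1 / 2" using exp_ge_add_one_self[of 1] by (simp add: exp_minus field_simps)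
      finally have half: "1 / 2 \<le> 1 - (1 - \<alpha>) ^ n" by simp
      have "(s * \<sigma>)\<^sup>2 / 2 \<le> (s * \<sigma>)\<^sup>2 * (1 - (1 - \<alpha>) ^ n)"
        using mult_left_mono[OF half, of "(s * \<sigma>)\<^sup>2"] by simp
      also have "\<dots> \<le> (\<rho> * real n powr l)\<^sup>2 * \<sigma>\<^sup>2"
        using level_set_covering[OF sum[OF n1] _ b refl, of "s * \<sigma>" a] \<rho> s \<sigma> by (simp add: \<alpha>_def)
      finally have "s\<^sup>2 \<le> 2 * (\<rho> * real n powr l)\<^sup>2"
        using \<sigma>(1) by (simp add: power_mult_distrib)
      also have "\<dots> \<le> (2 * \<rho> * real n powr l)\<^sup>2" by (simp add: power_mult_distrib)
      finally have "s \<le> 2 * \<rho> * real n powr l"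
        by (rule power2_le_imp_le) (use \<rho> in simp)
      also have "\<dots> \<le> 2 * \<rho> * (2 / \<alpha>) powr l"
        using \<rho> n l0 by (intro mult_left_mono powr_mono2) auto
      finally have "s powr (1 / l) \<le> (2 * \<rho> * (2 / \<alpha>) powr l) powr (1 / l)"
        using s l0 by (intro powr_mono2) auto
      also have "\<dots> = (2 * \<rho>) powr (1 / l) * (2 / \<alpha>)"
        using \<rho> \<alpha> l0 by (simp add: powr_mult powr_powr)
      also have "\<dots> = D / \<alpha>" by (simp add: D_def)
      finally show ?thesis using \<alpha> s by (simp add: powr_minus field_simps)
    qed
    then show "prob {\<omega>. s * sqrt (\<Sum>i<k. (cmod (a i))\<^sup>2) < cmod (\<Sum>i<k. a i * b i \<omega>)}
        \<le> D * s powr (- (1 / l))"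
      by (simp add: \<alpha>_def \<sigma>_def)
  qed
qed

text \<open>The exponent 1/(p+1) yields level sets decaying like s^(-(p+1)), one power better than
  the p-th moment demands. That spare power makes the dyadic series geometric with ratio
  1/2.\<close>

lemma Lambda_p_set_if_limit_exponents:
  assumes p: "2 < p" and l: "1 / (p + 1) \<in> limit_exponents m \<Lambda> \<infinity> \<infinity>"
  shows "Lambda_p_set m p \<Lambda>"
proof -
  obtain D where D: "0 < D" and decay:
    "\<And>(k::nat) b a s. inj_on b {..<k} \<Longrightarrow> b ` {..<k} \<subseteq> \<Lambda> \<Longrightarrow> 0 < (\<Sum>i<k. (cmod (a i))\<^sup>2) \<Longrightarrow> 0 < s \<Longrightarrow>
       prob {\<omega>. s * sqrt (\<Sum>i<k. (cmod (a i))\<^sup>2) < cmod (\<Sum>i<k. a i * b i \<omega>)}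
         \<le> D * s powr (- (1 / (1 / (p + 1))))"
    using level_set_decay[OF l] by blast
  \<comment> \<open>The 1 bounds the part where |f| is at most its L_2 norm, 2^p arises from
    estimating each dyadic level by its upper end, and the last 2 is the sum of the geometric
    series.\<close>
  define C where "C = 1 + 2 powr p * D * 2"
  have C: "0 < C" using D by (simp add: C_def add_pos_pos)
  have "Lp_norm p m f \<le> C powr (1 / p) * Lp_norm 2 m f" if span: "f \<in> module.span scale_fun \<Lambda>" for f
  proof -
    obtain k :: nat and b and a :: "nat \<Rightarrow> complex" where b: "inj_on b {..<k}" "b ` {..<k} \<subseteq> \<Lambda>"
      and f: "f = (\<lambda>\<omega>. \<Sum>i<k. a i * b i \<omega>)"
      using span_scale_fun_obtain[OF span] by blast
    define \<sigma> where "\<sigma> = sqrt (\<Sum>i<k. (cmod (a i))\<^sup>2)"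
    have L2: "Lp_norm 2 m f = \<sigma>" unfolding f \<sigma>_def using b by (rule Lp_norm_2_character_sum)
    show ?thesis
    proof (cases "\<sigma> = 0")
      case True
      then have "\<forall>i<k. a i = 0" by (auto simp: \<sigma>_def sum_nonneg_eq_0_iff)
      then show ?thesis using True p by (simp add: L2 f Lp_norm_def)
    next
      case False
      then have \<sigma>: "0 < \<sigma>" by (simp add: \<sigma>_def sum_nonneg order_less_le)
      have fm [measurable]: "f \<in> borel_measurable m" unfolding f by (rule measurable_character_sum[OF b(2)])
      \<comment> \<open>A cut-off above the sup norm of f / \<sigma>; it depends on f but does not
        enter the final constant.\<close>
      obtain K :: nat where K: "(\<Sum>i<k. cmod (a i)) / \<sigma> < 2 ^ K"
        using real_arch_pow[of 2] by auto
      define A where "A i = {\<omega>. 2 ^ i * \<sigma> < cmod (f \<omega>)}" for i :: nat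
      have A [measurable]: "A i \<in> sets m" for i
      proof -
        have "{\<omega>\<in>space m. 2 ^ i * \<sigma> < cmod (f \<omega>)} \<in> sets m" by measurable
        then show ?thesis by (simp add: A_def space_haar)
      qed
      have intA: "integrable m (indicator (A i) :: _ \<Rightarrow> real)" for i
        using A by (intro integrable_real_indicator) (auto simp: emeasure_eq_measure)
      have pA: "prob (A i) \<le> D * 2 powr (- (real i * (p + 1)))" for i
      proof -
        have "0 < (\<Sum>i<k. (cmod (a i))\<^sup>2)" using \<sigma> by (simp add: \<sigma>_def)
        then have "prob (A i) \<le> D * (2 ^ i) powr (- (1 / (1 / (p + 1))))"
          using decay[OF b, of a "2 ^ i"] by (simp add: A_def f \<sigma>_def)
        also have "(2 ^ i) powr (- (1 / (1 / (p + 1)))) = 2 powr (- (real i * (p + 1)))"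
          by (subst powr_realpow[symmetric]) (simp_all add: powr_powr algebra_simps)
        finally show ?thesis .
      qed
      have pw: "cmod (f \<omega>) powr p
          \<le> \<sigma> powr p * (1 + (\<Sum>i<K. 2 powr (p * real (Suc i)) * indicator (A i) \<omega>))" for \<omega>
      proof -
        have "cmod (f \<omega>) / \<sigma> \<le> (\<Sum>i<k. cmod (a i)) / \<sigma>"
          unfolding f using cmod_character_sum_le[OF b(2)] \<sigma> by (intro divide_right_mono) auto
        then have "(cmod (f \<omega>) / \<sigma>) powr p
            \<le> 1 + (\<Sum>i<K. 2 powr (p * real (Suc i)) * (if 2 ^ i < cmod (f \<omega>) / \<sigma> then 1 else 0))"
          using K \<sigma> p by (intro dyadic_powr_bound) auto
        also have "\<dots> = 1 + (\<Sum>i<K. 2 powr (p * real (Suc i)) * indicator (A i) \<omega>)"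
          using \<sigma> by (intro arg_cong[of _ _ "\<lambda>x. 1 + x"] sum.cong) (auto simp: A_def indicator_def field_simps)
        finally have "\<sigma> powr p * (cmod (f \<omega>) / \<sigma>) powr p
            \<le> \<sigma> powr p * (1 + (\<Sum>i<K. 2 powr (p * real (Suc i)) * indicator (A i) \<omega>))"
          by (intro mult_left_mono) auto
        then show ?thesis using \<sigma> by (simp add: powr_divide)
      qed
      have geo: "(\<Sum>i<K. (1 / 2) ^ i) \<le> (2::real)"
        using sum_gp_strict[of "1 / 2 :: real" K] by simp
      have "(LINT \<omega>|m. cmod (f \<omega>) powr p)
          \<le> (LINT \<omega>|m. \<sigma> powr p * (1 + (\<Sum>i<K. 2 powr (p * real (Suc i)) * indicator (A i) \<omega>)))"
      proof (intro integral_mono pw)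
        show "integrable m (\<lambda>\<omega>. cmod (f \<omega>) powr p)"
          unfolding f using b p by (intro integrable_character_sum_powr) auto
        show "integrable m (\<lambda>\<omega>. \<sigma> powr p * (1 + (\<Sum>i<K. 2 powr (p * real (Suc i)) * indicator (A i) \<omega>)))"
          by (intro integrable_mult_right Bochner_Integration.integrable_add
              Bochner_Integration.integrable_sum intA) simp
      qed
      also have "\<dots> = \<sigma> powr p * (1 + (\<Sum>i<K. 2 powr (p * real (Suc i)) * prob (A i)))"
      proof -
        have "(LINT \<omega>|m. (\<Sum>i<K. 2 powr (p * real (Suc i)) * indicator (A i) \<omega>))
            = (\<Sum>i<K. (LINT \<omega>|m. 2 powr (p * real (Suc i)) * indicator (A i) \<omega>))"
          by (intro Bochner_Integration.integral_sum integrable_mult_right intA)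
        also have "\<dots> = (\<Sum>i<K. 2 powr (p * real (Suc i)) * prob (A i))"
          using A by (intro sum.cong) auto
        moreover have "(LINT \<omega>|m. 1 + (\<Sum>i<K. 2 powr (p * real (Suc i)) * indicator (A i) \<omega>))
            = (LINT \<omega>|m. 1) + (LINT \<omega>|m. (\<Sum>i<K. 2 powr (p * real (Suc i)) * indicator (A i) \<omega>))"
          by (intro Bochner_Integration.integral_add Bochner_Integration.integrable_sum
              integrable_mult_right intA) simp
        ultimately show ?thesis by (simp only: integral_mult_right_zero) (simp add: prob_space)
      qed
      also have "\<dots> \<le> \<sigma> powr p * (1 + (\<Sum>i<K. 2 powr p * D * (1 / 2) ^ i))"
      proof (intro mult_left_mono add_left_mono sum_mono)
        fix i
        have "2 powr (p * real (Suc i)) * prob (A i)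
            \<le> 2 powr (p * real (Suc i)) * (D * 2 powr (- (real i * (p + 1))))"
          using pA by (intro mult_left_mono) auto
        also have "\<dots> = D * 2 powr (p * real (Suc i) + (- (real i * (p + 1))))"
          by (simp only: powr_add mult_ac)
        also have "p * real (Suc i) + (- (real i * (p + 1))) = p + (- real i)"
          by (simp add: algebra_simps)
        also have "D * 2 powr (p + (- real i)) = 2 powr p * D * (1 / 2) ^ i"
          by (simp only: powr_add powr_minus powr_realpow) (simp add: power_divide powr_realpow field_simps)
        finally show "2 powr (p * real (Suc i)) * prob (A i) \<le> 2 powr p * D * (1 / 2) ^ i" .
      qed simp
      also have "\<dots> \<le> \<sigma> powr p * C"
        unfolding C_def sum_distrib_left[symmetric] using D geo
        by (intro mult_left_mono add_left_mono) auto
      finally have "Lp_norm p m f \<le> (\<sigma> powr p * C) powr (1 / p)"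
        unfolding Lp_norm_def using p by (intro powr_mono2 integral_nonneg_AE) auto
      also have "\<dots> = C powr (1 / p) * \<sigma>" using \<sigma> C p by (simp add: powr_mult powr_powr)
      finally show ?thesis by (simp add: L2)
    qed
  qed
  moreover have "0 < C powr (1 / p)" using C by simp
  ultimately show ?thesis unfolding Lambda_p_set_def by blast
qed

end

theorem theorem1:
  fixes m\<^sub>G :: "'g::{topological_ab_group_add, t2_space} measure"
    and \<Lambda> :: "('g \<Rightarrow> complex) set"
    and P :: "'w measure" and g :: "nat \<Rightarrow> 'w \<Rightarrow> real"
  assumes "compact (UNIV :: 'g set)"
    and "normalized_haar_measure m\<^sub>G"
    and "\<Lambda> \<subseteq> characters" and "infinite \<Lambda>"
    and "independent_standard_gaussians P g"
  shows "(\<forall>p::real. 2 < p \<longrightarrow> Lambda_p_set m\<^sub>G p \<Lambda>) \<longleftrightarrow>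
         (\<forall>u v::ereal. 1 \<le> u \<and> 1 \<le> v \<longrightarrow>
            limit_order (pi_summing m\<^sub>G \<Lambda>) u v = limit_order (pi_summing P (gaussian_system g)) u v)"
proof -
  interpret G: lacunary_system P "gaussian_system g"
    using assms(5) by (rule gaussian_lacunary)
  interpret character_system m\<^sub>G \<Lambda>
    using assms by unfold_locales
  show ?thesis
  proof (intro iffI allI impI; (elim conjE)?)
    fix u v :: ereal
    assume "\<forall>p::real. 2 < p \<longrightarrow> Lambda_p_set m\<^sub>G p \<Lambda>" and uv: "1 \<le> u" "1 \<le> v"
    then interpret L: lacunary_system m\<^sub>G \<Lambda>
      by (intro Lambda_p_imp_lacunary) auto
    show "limit_order (pi_summing m\<^sub>G \<Lambda>) u v = limit_order (pi_summing P (gaussian_system g)) u v"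
      using uv G.lacunary_system_axioms L.lacunary_system_axioms
      by (intro antisym L.limit_order_le G.limit_order_le)
  next
    fix p :: real
    assume eq: "\<forall>u v::ereal. 1 \<le> u \<and> 1 \<le> v \<longrightarrow>
      limit_order (pi_summing m\<^sub>G \<Lambda>) u v = limit_order (pi_summing P (gaussian_system g)) u v"
      and p: "2 < p"
    then have "limit_order (pi_summing m\<^sub>G \<Lambda>) \<infinity> \<infinity> \<le> 0"
      using G.limit_order_infinity_infinity by simp
    \<comment> \<open>Positivity puts 1/(p+1) strictly above the limit order, so it is an admissible
      exponent.\<close>
    also have "0 < ereal (1 / (p + 1))" using p by simp
    finally have "1 / (p + 1) \<in> limit_exponents m\<^sub>G \<Lambda> \<infinity> \<infinity>" by (rule less_limit_order_imp_mem)
    with p show "Lambda_p_set m\<^sub>G p \<Lambda>" by (rule Lambda_p_set_if_limit_exponents)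
  qed
qed

end
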